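(* Let $0\le\delta<1$ and let $(X_t)$ be a solution to the martingale problem with respect to $\mathcal D_{L^\delta}$. Suppose the following. i) For almost all $t\in\,]0,T]$ the law of $X_t$ admits a density $p_t$. ii) $\displaystyle\lim_{|x|\to0}\int_0^T|x|^{1-\delta}p_t(x)\,dt=0$. Then $(X_t)$ is also a solution to the martingale problem with respect to the extended domain $\hat{\mathcal D}_{L^\delta}$.
   Context: $T>0$ is fixed. $\mathbb R_+=[0,\infty)$, $\mathbb R_-=(-\infty,0]$, $\mathbb R^*=\mathbb R\setminus\{0\}$; $C^k(I)$ is the space of real functions on $I$ with continuous derivatives up to order $k$. Consider, for a function $f$ that is $C^2$ on $\mathbb R^*$, the conditions: (a) there is a continuous $g:\mathbb R\to\mathbb R$ extending $x\mapsto f'(x)|x|^{\delta-1}$, $x\neq0$; (b) there is a continuous $G:\mathbb R\to\mathbb R$ extending $x\mapsto g'(x)|x|^{1-\delta}$, $x\ne0$. When they hold one sets $L^\delta f:=G/2$; thus $L^\delta f(x)=\frac{f''(x)}2+\frac{(\delta-1)f'(x)}{2x}$ for $x\neq0$. $\mathcal D_{L^\delta}$ is the set of continuous $f:\mathbb R\to\mathbb R$ whose restrictions to $\mathbb R_+$ and to $\mathbb R_-$ are of class $C^2$ and which satisfy (a) and (b). $\hat{\mathcal D}_{L^\delta}$ is the larger set of $f\in C(\mathbb R)\cap C^2(\mathbb R^* )$ satisfying (a) and (b). (All such $f$ are $C^1$ with $f'(0)=0$.) For $\mathcal D\in\{\mathcal D_{L^\delta},\hat{\mathcal D}_{L^\delta}\}$,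 a continuous real process $X$ with deterministic initial value $X_0=x_0$ on a probability space $(\Omega,\mathcal F,\mathbb P)$ solves the martingale problem with respect to $\mathcal D$ if for every $f\in\mathcal D$ the process $f(X_t)-f(x_0)-\int_0^tL^\delta f(X_s)\,ds$, $t\in[0,T]$, is a $\mathbb P$-local martingale (with respect to the canonical filtration of $X$, satisfying the usual conditions). *)

theory Defs
  imports "HOL-Probability.Probability"
begin

section \<open>The operator and its domains\<close>

text \<open>Derivatives are taken within \<open>I\<close>, hence one-sided at an endpoint of a closed half-line.\<close>

definition Ck_on :: "nat \<Rightarrow> real set \<Rightarrow> (real \<Rightarrow> real) \<Rightarrow> bool" where
  "Ck_on k I f \<longleftrightarrow> (\<exists>D.
     (\<forall>x\<in>I. D 0 x = f x) \<and>
     (\<forall>j<k. \<forall>x\<in>I. (D j has_real_derivative D (Suc j) x) (at x within I)) \<and>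
     (\<forall>j\<le>k. continuous_on I (D j)))"

definition continuous_extension :: "(real \<Rightarrow> real) \<Rightarrow> (real \<Rightarrow> real) \<Rightarrow> bool" where
  "continuous_extension h g \<longleftrightarrow> continuous_on UNIV g \<and> (\<forall>x. x \<noteq> 0 \<longrightarrow> g x = h x)"

lemma continuous_extension_unique:
  assumes "continuous_extension h g1" "continuous_extension h g2"
  shows "g1 = g2"
proof
  fix x
  have eq: "g1 y = g2 y" if "y \<noteq> 0" for y
    using assms that by (simp add: continuous_extension_def)
  have "g1 \<midarrow>0\<rightarrow> g1 0" "g2 \<midarrow>0\<rightarrow> g2 0"
    using assms by (auto simp: continuous_extension_def continuous_on_def)
  moreover have "(g1 \<longlongrightarrow> g2 0) (at 0) \<longleftrightarrow> (g2 \<longlongrightarrow> g2 0) (at 0)"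
    by (rule Lim_cong_within) (auto simp: eq)
  ultimately have "g1 0 = g2 0"
    using LIM_unique by blast
  then show "g1 x = g2 x"
    using eq by (cases "x = 0") auto
qed

text \<open>Only meaningful if a continuous extension exists; by the previous lemma it is then unique.\<close>

definition ext0 :: "(real \<Rightarrow> real) \<Rightarrow> real \<Rightarrow> real" where
  "ext0 h = (THE g. continuous_extension h g)"

lemma ext0_eq: "continuous_extension h g \<Longrightarrow> ext0 h = g"
  unfolding ext0_def by (blast intro: continuous_extension_unique)

definition scaled_deriv :: "real \<Rightarrow> (real \<Rightarrow> real) \<Rightarrow> real \<Rightarrow> real" where
  "scaled_deriv \<delta> f x = deriv f x * \<bar>x\<bar> powr (\<delta> - 1)"

definition scaled_deriv2 :: "real \<Rightarrow> (real \<Rightarrow> real) \<Rightarrow> real \<Rightarrow> real" where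
  "scaled_deriv2 \<delta> f x = deriv (ext0 (scaled_deriv \<delta> f)) x * \<bar>x\<bar> powr (1 - \<delta>)"

definition admissible :: "real \<Rightarrow> (real \<Rightarrow> real) \<Rightarrow> bool" where
  "admissible \<delta> f \<longleftrightarrow>
     (\<exists>g. continuous_extension (scaled_deriv \<delta> f) g) \<and>
     (\<exists>G. continuous_extension (scaled_deriv2 \<delta> f) G)"

definition L_op :: "real \<Rightarrow> (real \<Rightarrow> real) \<Rightarrow> real \<Rightarrow> real" where
  "L_op \<delta> f x = ext0 (scaled_deriv2 \<delta> f) x / 2"

definition dom_L :: "real \<Rightarrow> (real \<Rightarrow> real) set" where
  "dom_L \<delta> = {f. continuous_on UNIV f \<and> Ck_on 2 {0..} f \<and> Ck_on 2 {..0} f \<and> admissible \<delta> f}"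

definition dom_L_hat :: "real \<Rightarrow> (real \<Rightarrow> real) set" where
  "dom_L_hat \<delta> = {f. continuous_on UNIV f \<and> Ck_on 2 (- {0}) f \<and> admissible \<delta> f}"

lemma L_op_eq:
  assumes f: "f \<in> dom_L_hat \<delta>" and x: "x \<noteq> 0"
  shows "L_op \<delta> f x = deriv (deriv f) x / 2 + (\<delta> - 1) * deriv f x / (2 * x)"
proof -
  have ad: "admissible \<delta> f" and "Ck_on 2 (- {0}) f"
    using f by (auto simp: dom_L_hat_def)
  then obtain D where D0: "\<And>x. x \<noteq> 0 \<Longrightarrow> D 0 x = f x"
    and D: "\<And>j x. j < 2 \<Longrightarrow> x \<noteq> 0 \<Longrightarrow> (D j has_real_derivative D (Suc j) x) (at x)"
    by (auto simp: Ck_on_def at_within_open[of _ "- {0::real}"] open_Compl)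
  have ev: "\<forall>\<^sub>F y in nhds z. y \<noteq> 0" if "z \<noteq> 0" for z :: real
    using that by (rule t1_space_nhds)
  have d1: "deriv f z = D 1 z" if "z \<noteq> 0" for z
  proof -
    have "deriv f z = deriv (D 0) z"
      by (rule deriv_cong_ev) (use ev[OF that] in \<open>auto elim!: eventually_mono simp: D0\<close>)
    then show ?thesis using DERIV_imp_deriv[OF D[of 0 z]] that by simp
  qed
  have d2: "deriv (deriv f) x = D 2 x"
  proof -
    have "deriv (deriv f) x = deriv (D 1) x"
      by (rule deriv_cong_ev) (use ev[OF x] in \<open>auto elim!: eventually_mono simp: d1\<close>)
    then show ?thesis using DERIV_imp_deriv[OF D[of 1 x]] x by (simp add: numeral_2_eq_2)
  qed
  obtain g where g: "continuous_extension (scaled_deriv \<delta> f) g"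
    using ad by (auto simp: admissible_def)
  obtain G where G: "continuous_extension (scaled_deriv2 \<delta> f) G"
    using ad by (auto simp: admissible_def)
  have "deriv g x = deriv (\<lambda>y. D 1 y * \<bar>y\<bar> powr (\<delta> - 1)) x"
    by (rule deriv_cong_ev)
       (use ev[OF x] g in \<open>auto elim!: eventually_mono simp: continuous_extension_def scaled_deriv_def d1\<close>)
  also have "\<dots> = D 2 x * \<bar>x\<bar> powr (\<delta> - 1) + D 1 x * ((\<delta> - 1) * \<bar>x\<bar> powr (\<delta> - 1) / x)"
  proof (rule DERIV_imp_deriv)
    have P: "((\<lambda>y. \<bar>y\<bar> powr (\<delta> - 1)) has_real_derivative
        (\<delta> - 1) * \<bar>x\<bar> powr (\<delta> - 1) / x) (at x)"
    proof -
      have "\<forall>\<^sub>F y in nhds x. \<bar>y\<bar> powr (\<delta> - 1) = (sgn x * y) powr (\<delta> - 1)"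
      proof (cases "x > 0")
        case True
        then have "\<forall>\<^sub>F y in nhds x. y > 0" by (rule order_tendstoD(1)[OF filterlim_ident])
        then show ?thesis using True by (auto elim!: eventually_mono)
      next
        case False
        then have "x < 0" using x by simp
        then have "\<forall>\<^sub>F y in nhds x. y < 0" by (rule order_tendstoD(2)[OF filterlim_ident])
        then show ?thesis using \<open>x < 0\<close> by (auto elim!: eventually_mono)
      qed
      moreover have "((\<lambda>y. (sgn x * y) powr (\<delta> - 1)) has_real_derivative
          (\<delta> - 1) * (sgn x * x) powr (\<delta> - 1 - 1) * sgn x) (at x)"
      proof (rule DERIV_chain2[OF has_real_derivative_powr])
        show "((\<lambda>y. sgn x * y) has_real_derivative sgn x) (at x)"
          by (rule DERIV_cmult_Id)
      qed (use x in \<open>auto simp: sgn_if\<close>)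
      moreover have "(\<delta> - 1) * (sgn x * x) powr (\<delta> - 1 - 1) * sgn x
          = (\<delta> - 1) * \<bar>x\<bar> powr (\<delta> - 1) / x"
        using x by (subst powr_diff[of _ "\<delta> - 1" 1]) (auto simp: sgn_if abs_if)
      ultimately show ?thesis
        using DERIV_cong_ev[OF refl _ refl] by metis
    qed
    show "((\<lambda>y. D 1 y * \<bar>y\<bar> powr (\<delta> - 1)) has_real_derivative
        D 2 x * \<bar>x\<bar> powr (\<delta> - 1) + D 1 x * ((\<delta> - 1) * \<bar>x\<bar> powr (\<delta> - 1) / x)) (at x)"
      using DERIV_mult[OF D[of 1 x] P] x by (simp add: numeral_2_eq_2 algebra_simps)
  qed
  finally have "deriv g x = (D 2 x + D 1 x * (\<delta> - 1) / x) * \<bar>x\<bar> powr (\<delta> - 1)"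
    by (simp add: algebra_simps)
  moreover have "\<bar>x\<bar> powr (\<delta> - 1) * \<bar>x\<bar> powr (1 - \<delta>) = 1"
    using x by (simp flip: powr_add)
  ultimately have "deriv g x * \<bar>x\<bar> powr (1 - \<delta>) = D 2 x + D 1 x * (\<delta> - 1) / x"
    by (simp add: mult.assoc)
  moreover have "L_op \<delta> f x = deriv g x * \<bar>x\<bar> powr (1 - \<delta>) / 2"
    using G x by (simp add: L_op_def ext0_eq[OF G] continuous_extension_def scaled_deriv2_def ext0_eq[OF g])
  ultimately show ?thesis
    using x by (simp add: d1 d2 field_simps)
qed

lemma dom_L_subset_dom_L_hat: "dom_L \<delta> \<subseteq> dom_L_hat \<delta>"
proof
  fix f assume "f \<in> dom_L \<delta>"
  then have f: "continuous_on UNIV f" "Ck_on 2 {0..} f" "Ck_on 2 {..0} f" "admissible \<delta> f"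
    by (auto simp: dom_L_def)
  obtain D where D: "\<And>x. x \<ge> 0 \<Longrightarrow> D 0 x = f x"
    "\<And>j x. j < 2 \<Longrightarrow> x \<ge> 0 \<Longrightarrow> (D j has_real_derivative D (Suc j) x) (at x within {0..})"
    "\<And>j. j \<le> 2 \<Longrightarrow> continuous_on {0..} (D j)"
    using f(2) by (auto simp: Ck_on_def)
  obtain E where E: "\<And>x. x \<le> 0 \<Longrightarrow> E 0 x = f x"
    "\<And>j x. j < 2 \<Longrightarrow> x \<le> 0 \<Longrightarrow> (E j has_real_derivative E (Suc j) x) (at x within {..0})"
    "\<And>j. j \<le> 2 \<Longrightarrow> continuous_on {..0} (E j)"
    using f(3) by (auto simp: Ck_on_def)
  define H where "H = (\<lambda>j x. if x > 0 then D j x else E j x)"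
  have H: "\<forall>\<^sub>F y in nhds x. H j y = (if x > 0 then D j y else E j y)" if "x \<noteq> 0" for x j
  proof (cases "x > 0")
    case True
    then have "\<forall>\<^sub>F y in nhds x. y > 0" by (rule order_tendstoD(1)[OF filterlim_ident])
    then show ?thesis using True by (auto elim!: eventually_mono simp: H_def)
  next
    case False
    then have "x < 0" using that by simp
    then have "\<forall>\<^sub>F y in nhds x. y < 0" by (rule order_tendstoD(2)[OF filterlim_ident])
    then show ?thesis using False by (auto elim!: eventually_mono simp: H_def)
  qed
  have dH: "(H j has_real_derivative H (Suc j) x) (at x)" if "x \<noteq> 0" "j < 2" for x j
  proof (cases "x > 0")
    case True
    have "(D j has_real_derivative D (Suc j) x) (at x within {0<..})"
      by (rule DERIV_subset[OF D(2)]) (use True that in auto)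
    then have "(D j has_real_derivative D (Suc j) x) (at x)"
      using True by (simp add: at_within_open[of x "{0<..}"])
    then show ?thesis
      using DERIV_cong_ev[OF refl H[OF that(1), of j] refl] True by (simp add: H_def)
  next
    case False
    have "(E j has_real_derivative E (Suc j) x) (at x within {..<0})"
      by (rule DERIV_subset[OF E(2)]) (use False that in auto)
    then have "(E j has_real_derivative E (Suc j) x) (at x)"
      using False that by (simp add: at_within_open[of x "{..<0}"])
    then show ?thesis
      using DERIV_cong_ev[OF refl H[OF that(1), of j] refl] False by (simp add: H_def)
  qed
  have cH: "continuous_on (- {0}) (H j)" if "j \<le> 2" for j
  proof -
    have "- {0::real} = {0<..} \<union> {..<0}" by auto
    moreover have "continuous_on {0<..} (H j)"
      by (subst continuous_on_cong[OF refl, where g="D j"])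
         (auto simp: H_def intro: continuous_on_subset[OF D(3)[OF that]])
    moreover have "continuous_on {..<0} (H j)"
      by (subst continuous_on_cong[OF refl, where g="E j"])
         (auto simp: H_def intro: continuous_on_subset[OF E(3)[OF that]])
    ultimately show ?thesis
      by (simp add: continuous_on_open_Un)
  qed
  have "\<forall>x\<in>- {0}. H 0 x = f x"
    by (auto simp: H_def D(1) E(1))
  moreover have "\<forall>j<2. \<forall>x\<in>- {0}. (H j has_real_derivative H (Suc j) x) (at x within - {0})"
    using dH has_field_derivative_at_within by blast
  ultimately have "Ck_on 2 (- {0}) f"
    using cH unfolding Ck_on_def by blast
  then show "f \<in> dom_L_hat \<delta>"
    using f by (simp add: dom_L_hat_def)
qed

section \<open>Local martingales on a compact time interval\<close>

text \<open>The time index ranges over all reals to fit the library's notion of stopping time;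
  processes are only considered on \<open>{0..T}\<close>.\<close>

definition martingale_upto ::
  "'a measure \<Rightarrow> (real \<Rightarrow> 'a measure) \<Rightarrow> real \<Rightarrow> (real \<Rightarrow> 'a \<Rightarrow> real) \<Rightarrow> bool" where
  "martingale_upto M F T Y \<longleftrightarrow>
     (\<forall>t\<in>{0..T}. Y t \<in> borel_measurable (F t) \<and> integrable M (Y t)) \<and>
     (\<forall>s\<in>{0..T}. \<forall>t\<in>{s..T}. AE \<omega> in M. real_cond_exp M (F s) (Y t) \<omega> = Y s \<omega>)"

text \<open>Since \<open>T\<close> belongs to the time interval, the localizing sequence has to reach \<open>T\<close>
  after finitely many steps rather than merely converge to it.\<close>

definition local_martingale_upto ::
  "'a measure \<Rightarrow> (real \<Rightarrow> 'a measure) \<Rightarrow> real \<Rightarrow> (real \<Rightarrow> 'a \<Rightarrow> real) \<Rightarrow> bool" where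
  "local_martingale_upto M F T Y \<longleftrightarrow>
     (\<forall>t\<in>{0..T}. Y t \<in> borel_measurable (F t)) \<and>
     (\<exists>\<tau> :: nat \<Rightarrow> 'a \<Rightarrow> real.
        (\<forall>n. stopping_time F (\<tau> n)) \<and>
        (\<forall>n. \<forall>\<omega>\<in>space M. \<tau> n \<omega> \<in> {0..T}) \<and>
        (AE \<omega> in M. incseq (\<lambda>n. \<tau> n \<omega>) \<and> (\<exists>n. \<tau> n \<omega> = T)) \<and>
        (\<forall>n. martingale_upto M F T (\<lambda>t \<omega>. Y (min t (\<tau> n \<omega>)) \<omega>)))"

text \<open>Null sets are those of the completed probability space, so the filtration lives on
  \<open>completion M\<close>, not on \<open>M\<close>.\<close>

definition augmented_history ::
  "'a measure \<Rightarrow> real \<Rightarrow> (real \<Rightarrow> 'a \<Rightarrow> real) \<Rightarrow> real \<Rightarrow> 'a measure" where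
  "augmented_history M T X t = sigma (space M)
     (null_sets (completion M) \<union>
      {X s -` A \<inter> space M | s A. 0 \<le> s \<and> s \<le> min t T \<and> A \<in> sets borel})"

definition canonical_filtration ::
  "'a measure \<Rightarrow> real \<Rightarrow> (real \<Rightarrow> 'a \<Rightarrow> real) \<Rightarrow> real \<Rightarrow> 'a measure" where
  "canonical_filtration M T X t =
     sigma (space M) (\<Inter>u\<in>{t<..}. sets (augmented_history M T X u))"

lemma augmented_history_gen_subset:
  "null_sets (completion M) \<union>
      {X s -` A \<inter> space M | s A. 0 \<le> s \<and> s \<le> min t T \<and> A \<in> sets borel} \<subseteq> Pow (space M)"
  using sets.sets_into_space[of _ "completion M"] by fastforce

lemma sets_canonical_filtration:
  "sets (canonical_filtration M T X t) = (\<Inter>u\<in>{t<..}. sets (augmented_history M T X u))"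
proof -
  have sp: "space (augmented_history M T X u) = space M" for u
    unfolding augmented_history_def by (rule space_measure_of[OF augmented_history_gen_subset])
  have "sigma_algebra (space M) (\<Inter>u\<in>{t<..}. sets (augmented_history M T X u))"
  proof (rule sigma_algebra_iff2[THEN iffD2], intro conjI ballI allI impI)
    show "(\<Inter>u\<in>{t<..}. sets (augmented_history M T X u)) \<subseteq> Pow (space M)"
    proof
      fix S assume "S \<in> (\<Inter>u\<in>{t<..}. sets (augmented_history M T X u))"
      then have "S \<in> sets (augmented_history M T X (t + 1))" by simp
      then show "S \<in> Pow (space M)"
        using sets.sets_into_space sp by blast
    qed
  next
    fix S assume "S \<in> (\<Inter>u\<in>{t<..}. sets (augmented_history M T X u))"
    then show "space M - S \<in> (\<Inter>u\<in>{t<..}. sets (augmented_history M T X u))"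
      using sets.compl_sets[of S "augmented_history M T X u" for u] by (auto simp: sp)
  qed auto
  then show ?thesis
    unfolding canonical_filtration_def by (rule sigma_algebra.sets_measure_of_eq)
qed

lemma subalgebra_canonical_filtration:
  assumes "\<forall>t\<in>{0..T}. X t \<in> borel_measurable M"
  shows "subalgebra (completion M) (canonical_filtration M T X t)"
proof -
  have sub: "sets (augmented_history M T X u) \<subseteq> sets (completion M)" for u
  proof -
    have "null_sets (completion M) \<union>
        {X s -` A \<inter> space M | s A. 0 \<le> s \<and> s \<le> min u T \<and> A \<in> sets borel} \<subseteq> sets (completion M)"
    proof (rule Un_least)
      show "null_sets (completion M) \<subseteq> sets (completion M)"
        by (rule subsetI) (rule null_setsD2)
    qed (use assms in \<open>auto intro!: sets_completionI_sets measurable_sets[where A=borel]\<close>)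
    then have "sigma_sets (space (completion M)) (null_sets (completion M) \<union>
        {X s -` A \<inter> space M | s A. 0 \<le> s \<and> s \<le> min u T \<and> A \<in> sets borel}) \<subseteq> sets (completion M)"
      by (rule sets.sigma_sets_subset)
    then show ?thesis
      unfolding augmented_history_def
      by (simp only: sets_measure_of[OF augmented_history_gen_subset] space_completion)
  qed
  have "sets (canonical_filtration M T X t) \<subseteq> sets (augmented_history M T X (t + 1))"
    unfolding sets_canonical_filtration by (rule INF_lower) simp
  with sub[of "t + 1"] show ?thesis
    unfolding subalgebra_def by (simp add: canonical_filtration_def space_measure_of_conv)
qed

section \<open>The martingale problem\<close>

definition solves_martingale_problem ::
  "'a measure \<Rightarrow> real \<Rightarrow> real \<Rightarrow> (real \<Rightarrow> real) set \<Rightarrow> real \<Rightarrow> (real \<Rightarrow> 'a \<Rightarrow> real) \<Rightarrow> bool" where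
  "solves_martingale_problem M T \<delta> \<D> x0 X \<longleftrightarrow>
     (\<forall>t\<in>{0..T}. X t \<in> borel_measurable M) \<and>
     (\<forall>\<omega>\<in>space M. continuous_on {0..T} (\<lambda>t. X t \<omega>)) \<and>
     (\<forall>\<omega>\<in>space M. X 0 \<omega> = x0) \<and>
     (\<forall>f\<in>\<D>. local_martingale_upto (completion M) (canonical_filtration M T X) T
        (\<lambda>t \<omega>. f (X t \<omega>) - f x0 - (LINT s:{0..t}|lborel. L_op \<delta> f (X s \<omega>))))"

end

theory Submission
  imports Defs
begin

text \<open>A function \<open>f\<close> of the extended domain satisfies \<open>f' = g \<bar>x\<bar>\<^sup>1\<^sup>-\<^sup>\<delta>\<close> with \<open>g\<close> continuous, and it lies in
  the smaller domain as soon as \<open>g(0) = 0\<close>. If \<open>f\<close> and \<open>L f\<close> are bounded, subtract from \<open>g\<close> the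
  spike \<open>g(0) \<zeta>\<^sub>m\<close>, where \<open>\<zeta>\<^sub>m(0) = 1\<close> and \<open>\<zeta>\<^sub>m\<close> has height \<open>1\<close>, width \<open>2/m\<close> and slope of
  order \<open>m\<close>. This changes \<open>f\<close> by \<open>O(1/m)\<close> uniformly, and \<open>L f\<close> by
  \<open>O(m \<bar>x\<bar>\<^sup>1\<^sup>-\<^sup>\<delta>)\<close> on \<open>[-1/m, 1/m]\<close> only, which is small in mean along \<open>X\<close> by (ii). Hence the
  process attached to \<open>f\<close> is a limit in \<open>L\<^sup>1\<close> of bounded local martingales, so a martingale. In general,
  truncate \<open>f\<close> outside \<open>[-R, R]\<close> and stop \<open>X\<close> when it leaves this interval.\<close>

section \<open>A cutoff function\<close>

text \<open>On the positive half-line f'' = G + (1 - \<delta>) g x^(-\<delta>), so for \<delta> > 0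
  a nonzero g(0) makes f'' unbounded at 0. This separates the two domains, and it is why the
  correction acts on g and not on f. The correction to L f cannot in general be made uniformly
  small: m |x|^(1-\<delta>) is of order m^\<delta> at |x| = 1/m. It is small only on average.
  Exchanging the integrals, the mean of the time integral of m |X|^(1-\<delta>) over |X| <= 1/m is m
  times the space integral of q over [-1/m, 1/m], where q(x) is the quantity in (ii). The length 2/m
  cancels m, and at most twice the supremum of q near 0 remains, which tends to 0. The martingale
  property is handled through integrals over events A of F_s, because these pass to such limits.
  Boundedness is needed already before the limit: for a process that is only a local martingale, the
  integrals over A at two times need not agree.\<close>

definition pos_sq :: "real \<Rightarrow> real" where
  "pos_sq u = (max 0 u)\<^sup>2"

lemma pos_sq_deriv: "(pos_sq has_real_derivative 2 * max 0 u) (at u)"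
proof -
  consider "u > 0" | "u < 0" | "u = 0" by linarith
  then show ?thesis
  proof cases
    case 1
    have "((\<lambda>u. u\<^sup>2) has_real_derivative 2 * max 0 u) (at u)"
      using 1 by (auto intro!: derivative_eq_intros)
    then show ?thesis
      by (rule has_field_derivative_transform_within_open[where S="{0<..}"])
         (use 1 in \<open>auto simp: pos_sq_def\<close>)
  next
    case 2
    have "((\<lambda>u. 0) has_real_derivative 2 * max 0 u) (at u)"
      using 2 by (auto intro!: derivative_eq_intros)
    then show ?thesis
      by (rule has_field_derivative_transform_within_open[where S="{..<0}"])
         (use 2 in \<open>auto simp: pos_sq_def\<close>)
  next
    \<comment> \<open>At the kink the slope function of Caratheodory's criterion is
      \<open>max 0 z\<close> itself, because the square of \<open>max 0 z\<close> equals
      \<open>max 0 z * z\<close>.\<close>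
    case 3
    have "isCont (\<lambda>z::real. max 0 z) 0"
      by (intro continuous_intros)
    then show ?thesis
      unfolding CARAT_DERIV using 3
      by (intro exI[of _ "\<lambda>z. max 0 z"]) (auto simp: pos_sq_def power2_eq_square max_def)
  qed
qed

text \<open>A \<open>C\<^sup>1\<close> step: \<open>1\<close> on the negative half-line and \<open>0\<close> on \<open>{1..}\<close>.\<close>

definition cutoff :: "real \<Rightarrow> real" where
  "cutoff u = pos_sq (1 - pos_sq u)"

definition cutoff' :: "real \<Rightarrow> real" where
  "cutoff' u = - 4 * max 0 (1 - pos_sq u) * max 0 u"

lemma cutoff_deriv: "(cutoff has_real_derivative cutoff' u) (at u)"
proof -
  have "((\<lambda>u. 1 - pos_sq u) has_real_derivative 0 - 2 * max 0 u) (at u)"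
    by (intro derivative_intros pos_sq_deriv)
  from DERIV_chain2[OF pos_sq_deriv this] show ?thesis
    by (simp add: cutoff_def[abs_def] cutoff'_def mult_ac)
qed

lemma continuous_pos_sq [continuous_intros]:
  "continuous_on S h \<Longrightarrow> continuous_on S (\<lambda>x. pos_sq (h x))"
  unfolding pos_sq_def by (intro continuous_intros)

lemma continuous_cutoff [continuous_intros]:
  "continuous_on S h \<Longrightarrow> continuous_on S (\<lambda>x. cutoff (h x))"
  unfolding cutoff_def by (intro continuous_intros)

lemma continuous_cutoff' [continuous_intros]:
  "continuous_on S h \<Longrightarrow> continuous_on S (\<lambda>x. cutoff' (h x))"
  unfolding cutoff'_def by (intro continuous_intros)

lemma pos_sq_ge_1: "u \<ge> 1 \<Longrightarrow> pos_sq u \<ge> 1"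
  by (simp add: pos_sq_def max_def)

lemma cutoff_simps:
  "u \<le> 0 \<Longrightarrow> cutoff u = 1" "u \<ge> 1 \<Longrightarrow> cutoff u = 0"
  "u \<le> 0 \<Longrightarrow> cutoff' u = 0" "u \<ge> 1 \<Longrightarrow> cutoff' u = 0"
proof -
  show "cutoff u = 1" "cutoff' u = 0" if "u \<le> 0"
    using that by (simp_all add: cutoff_def cutoff'_def pos_sq_def max_def)
  show "cutoff u = 0" "cutoff' u = 0" if "u \<ge> 1"
    using pos_sq_ge_1[OF that] by (simp_all add: cutoff_def cutoff'_def pos_sq_def[of "1 - pos_sq u"])
qed

text \<open>The 4 collects the two factors 2 of the chain rule; for u < 1 the remaining factors of
  \<open>cutoff' u\<close> lie between 0 and 1.\<close>

lemma cutoff_bounds: "0 \<le> cutoff u" "cutoff u \<le> 1" "\<bar>cutoff' u\<bar> \<le> 4"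
proof -
  have nn: "pos_sq v \<ge> 0" for v by (simp add: pos_sq_def)
  show "0 \<le> cutoff u" by (simp add: cutoff_def nn)
  show "cutoff u \<le> 1"
    using nn[of u] by (simp add: cutoff_def pos_sq_def[of "1 - pos_sq u"] max_def power_le_one)
  show "\<bar>cutoff' u\<bar> \<le> 4"
  proof (cases "u \<ge> 1")
    case False
    have "max 0 (1 - pos_sq u) * max 0 u \<le> 1 * 1"
      by (rule mult_mono) (use nn[of u] False in auto)
    moreover have "0 \<le> max 0 (1 - pos_sq u) * max 0 u" by simp
    ultimately show ?thesis by (simp add: cutoff'_def abs_mult mult.assoc)
  qed (simp add: cutoff_simps)
qed

section \<open>The extended domain\<close>

text \<open>Near x the absolute value is the linear map \<open>sgn x * y\<close>, so one chain rule
  covers both signs.\<close>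

lemma abs_powr_deriv:
  fixes x a :: real
  assumes "x \<noteq> 0"
  shows "((\<lambda>y. \<bar>y\<bar> powr a) has_real_derivative a * \<bar>x\<bar> powr (a - 1) * sgn x) (at x)"
proof -
  have "((\<lambda>y. sgn x * y) has_real_derivative sgn x) (at x)"
    by (rule DERIV_cmult_Id)
  moreover have "sgn x * x > 0" using assms by (auto simp: sgn_if)
  ultimately have "((\<lambda>y. (sgn x * y) powr a) has_real_derivative
      a * (sgn x * x) powr (a - 1) * sgn x) (at x)"
    by (intro DERIV_chain2[OF has_real_derivative_powr])
  moreover have "sgn x * x = \<bar>x\<bar>" by (auto simp: sgn_if abs_if)
  ultimately have "((\<lambda>y. (sgn x * y) powr a) has_real_derivative
      a * \<bar>x\<bar> powr (a - 1) * sgn x) (at x)" by simp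
  then show ?thesis
  proof (rule has_field_derivative_transform_within_open[where S="{y. sgn x * y > 0}"])
    show "open {y. 0 < sgn x * y}"
      by (intro open_Collect_less continuous_intros)
    show "x \<in> {y. 0 < sgn x * y}" using \<open>sgn x * x > 0\<close> by simp
    show "(sgn x * y) powr a = \<bar>y\<bar> powr a" if "y \<in> {y. 0 < sgn x * y}" for y
      using that assms by (cases "x > 0") auto
  qed
qed

lemma abs_powr_mult_cancel:
  fixes x a :: real assumes "x \<noteq> 0"
  shows "\<bar>x\<bar> powr (a - 1) * \<bar>x\<bar> powr (1 - a) = 1" "\<bar>x\<bar> powr (1 - a) * \<bar>x\<bar> powr (a - 1) = 1"
  using assms by (simp_all flip: powr_add)

lemma continuous_abs_powr [continuous_intros]:
  fixes a :: real
  assumes "a > 0" "continuous_on S h"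
  shows "continuous_on S (\<lambda>x. \<bar>h x :: real\<bar> powr a)"
  by (rule continuous_on_powr') (use assms in \<open>auto intro!: continuous_intros\<close>)

text \<open>Functions are rebuilt below from their derivative g |x|^(1-\<delta>). Prescribing the
  value at 0 makes the result comparable with a given function.\<close>

lemma ex_antiderivative:
  fixes h :: "real \<Rightarrow> real"
  assumes "continuous_on UNIV h"
  obtains F where "F 0 = c" "\<And>x. (F has_real_derivative h x) (at x)"
proof -
  have "\<exists>F. \<forall>x. (-\<infinity>::ereal) < ereal x \<longrightarrow> ereal x < \<infinity> \<longrightarrow> (F has_vector_derivative h x) (at x)"
    by (rule einterval_antiderivative)
       (use assms in \<open>auto simp: continuous_on_eq_continuous_at\<close>)
  then obtain F where F: "\<And>x. (F has_real_derivative h x) (at x)"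
    by (auto simp: has_real_derivative_iff_has_vector_derivative)
  show ?thesis
    by (rule that[of "\<lambda>x. F x - F 0 + c"])
       (use F in \<open>auto intro!: derivative_eq_intros\<close>)
qed

text \<open>\<open>g\<close> and \<open>G\<close> are the extensions of conditions (a) and (b). The junk value \<open>0 powr a = 0\<close>
  encodes \<open>f'(0) = 0\<close>.\<close>

definition L_triple :: "real \<Rightarrow> (real \<Rightarrow> real) \<Rightarrow> (real \<Rightarrow> real) \<Rightarrow> (real \<Rightarrow> real) \<Rightarrow> bool" where
  "L_triple \<delta> f g G \<longleftrightarrow> continuous_on UNIV g \<and> continuous_on UNIV G \<and>
     (\<forall>x. (f has_real_derivative g x * \<bar>x\<bar> powr (1 - \<delta>)) (at x)) \<and>
     (\<forall>x. x \<noteq> 0 \<longrightarrow> (g has_real_derivative G x * \<bar>x\<bar> powr (\<delta> - 1)) (at x))"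

lemma L_tripleD:
  assumes "L_triple \<delta> f g G"
  shows "continuous_on UNIV f" "continuous_on UNIV g" "continuous_on UNIV G"
    "(f has_real_derivative g x * \<bar>x\<bar> powr (1 - \<delta>)) (at x)"
    "x \<noteq> 0 \<Longrightarrow> (g has_real_derivative G x * \<bar>x\<bar> powr (\<delta> - 1)) (at x)"
  using assms unfolding L_triple_def
  by (auto intro!: continuous_at_imp_continuous_on DERIV_isCont)

lemma L_triple_diff:
  assumes "L_triple \<delta> f1 g1 G1" "L_triple \<delta> f2 g2 G2"
  shows "L_triple \<delta> (\<lambda>x. f1 x - c * f2 x) (\<lambda>x. g1 x - c * g2 x) (\<lambda>x. G1 x - c * G2 x)"
  unfolding L_triple_def
proof (intro conjI allI impI)
  show "((\<lambda>x. f1 x - c * f2 x) has_real_derivative (g1 x - c * g2 x) * \<bar>x\<bar> powr (1 - \<delta>)) (at x)" for x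
    by (rule DERIV_cong[OF DERIV_diff[OF L_tripleD(4)[OF assms(1)] DERIV_cmult[OF L_tripleD(4)[OF assms(2)]]]])
       (simp add: algebra_simps)
  show "((\<lambda>x. g1 x - c * g2 x) has_real_derivative (G1 x - c * G2 x) * \<bar>x\<bar> powr (\<delta> - 1)) (at x)"
    if "x \<noteq> 0" for x
    by (rule DERIV_cong[OF DERIV_diff[OF L_tripleD(5)[OF assms(1) that] DERIV_cmult[OF L_tripleD(5)[OF assms(2) that]]]])
       (simp add: algebra_simps)
qed (use assms in \<open>auto intro!: continuous_intros simp: L_triple_def\<close>)

text \<open>Reduces the negative half-line to the positive one. The second-order object G keeps its
  sign under reflection, the first-order object g changes it.\<close>

lemma L_triple_reflect:
  assumes "L_triple \<delta> f g G"
  shows "L_triple \<delta> (\<lambda>x. f (- x)) (\<lambda>x. - g (- x)) (\<lambda>x. G (- x))"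
  unfolding L_triple_def
proof (intro conjI allI impI)
  have m: "(uminus has_real_derivative -1) (at x)" for x :: real
    by (auto intro!: derivative_eq_intros)
  show "((\<lambda>x. f (- x)) has_real_derivative - g (- x) * \<bar>x\<bar> powr (1 - \<delta>)) (at x)" for x
    using DERIV_chain2[OF L_tripleD(4)[OF assms] m[of x]] by simp
  show "((\<lambda>x. - g (- x)) has_real_derivative G (- x) * \<bar>x\<bar> powr (\<delta> - 1)) (at x)" if "x \<noteq> 0" for x
    using DERIV_minus[OF DERIV_chain2[OF L_tripleD(5)[OF assms] m[of x]]] that by simp
  show "continuous_on UNIV (\<lambda>x. - g (- x))"
    by (intro continuous_intros continuous_on_compose2[OF L_tripleD(2)[OF assms]]) auto
  show "continuous_on UNIV (\<lambda>x. G (- x))"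
    by (intro continuous_intros continuous_on_compose2[OF L_tripleD(3)[OF assms]]) auto
qed

text \<open>Membership in the domain does not assert differentiability at 0. It follows because f' =
  g |x|^(1-\<delta>) off 0 extends continuously: f minus an antiderivative of the extension is
  continuous with zero derivative off one point, hence constant.\<close>

lemma dom_L_hat_imp_L_triple:
  assumes f: "f \<in> dom_L_hat \<delta>" and "\<delta> < 1"
  obtains g G where "L_triple \<delta> f g G" "\<And>x. L_op \<delta> f x = G x / 2"
proof -
  have ad: "admissible \<delta> f" and cf: "continuous_on UNIV f" and "Ck_on 2 (- {0}) f"
    using f by (auto simp: dom_L_hat_def)
  then obtain D where D0: "\<And>x. x \<noteq> 0 \<Longrightarrow> D 0 x = f x"
    and D: "\<And>j x. j < 2 \<Longrightarrow> x \<noteq> 0 \<Longrightarrow> (D j has_real_derivative D (Suc j) x) (at x)"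
    by (auto simp: Ck_on_def at_within_open[of _ "- {0::real}"] open_Compl)
  obtain g where g: "continuous_extension (scaled_deriv \<delta> f) g"
    using ad by (auto simp: admissible_def)
  obtain G where G: "continuous_extension (scaled_deriv2 \<delta> f) G"
    using ad by (auto simp: admissible_def)
  have cg: "continuous_on UNIV g" and cG: "continuous_on UNIV G"
    using g G by (auto simp: continuous_extension_def)
  have d1: "(f has_real_derivative D 1 x) (at x)" if "x \<noteq> 0" for x
    by (rule has_field_derivative_transform_within_open[where S="- {0}" and f="D 0"])
       (use D[of 0 x] D0 that in auto)
  have g1: "g x = D 1 x * \<bar>x\<bar> powr (\<delta> - 1)" if "x \<noteq> 0" for x
    using g that DERIV_imp_deriv[OF d1[OF that]] by (simp add: continuous_extension_def scaled_deriv_def)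
  have df: "(f has_real_derivative g x * \<bar>x\<bar> powr (1 - \<delta>)) (at x)" if "x \<noteq> 0" for x
    using d1[OF that] by (simp add: g1[OF that] mult.assoc abs_powr_mult_cancel[OF that])
  have dg: "(g has_real_derivative G x * \<bar>x\<bar> powr (\<delta> - 1)) (at x)" if "x \<noteq> 0" for x
  proof -
    \<comment> \<open>The value of the derivative is left open: condition (b) identifies it with G x
      |x|^(\<delta>-1), so f'' is never computed here.\<close>
    have "\<exists>d. ((\<lambda>x. D 1 x * \<bar>x\<bar> powr (\<delta> - 1)) has_real_derivative d) (at x)"
      using DERIV_mult[OF D[of 1 x] abs_powr_deriv] that by (auto intro: exI)
    then obtain d where "((\<lambda>x. D 1 x * \<bar>x\<bar> powr (\<delta> - 1)) has_real_derivative d) (at x)" ..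
    then have d: "(g has_real_derivative d) (at x)"
      by (rule has_field_derivative_transform_within_open[where S="- {0}"]) (use that g1 in auto)
    have "G x = deriv g x * \<bar>x\<bar> powr (1 - \<delta>)"
      using G that by (simp add: continuous_extension_def scaled_deriv2_def ext0_eq[OF g])
    then have "G x * \<bar>x\<bar> powr (\<delta> - 1) = d"
      using DERIV_imp_deriv[OF d] by (simp add: mult.assoc abs_powr_mult_cancel[OF that])
    with d show ?thesis by simp
  qed
  have df0: "(f has_real_derivative g x * \<bar>x\<bar> powr (1 - \<delta>)) (at x)" for x
  proof -
    have "continuous_on UNIV (\<lambda>x. g x * \<bar>x\<bar> powr (1 - \<delta>))"
      using \<open>\<delta> < 1\<close> by (intro continuous_intros cg) auto
    then obtain F where F: "F 0 = f 0" "\<And>x. (F has_real_derivative g x * \<bar>x\<bar> powr (1 - \<delta>)) (at x)"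
      by (rule ex_antiderivative[where c="f 0"]) blast
    have "f y - F y = f 0 - F 0" for y
    proof (rule has_derivative_zero_unique_strong_connected[where S=UNIV and K="{0}" and f="\<lambda>y. f y - F y"])
      show "continuous_on UNIV (\<lambda>y. f y - F y)"
        using F(2) by (intro continuous_intros cf continuous_at_imp_continuous_on ballI)
                      (auto intro: DERIV_isCont)
      fix y :: real assume "y \<in> UNIV - {0}"
      then have "((\<lambda>y. f y - F y) has_real_derivative 0) (at y)"
        using DERIV_diff[OF df F(2)] by simp
      then show "((\<lambda>y. f y - F y) has_derivative (\<lambda>h. 0)) (at y within UNIV)"
        by (simp add: has_field_derivative_def lambda_zero)
    qed auto
    then have "f = F" using F(1) by auto
    then show ?thesis using F(2) by simp
  qed
  have "L_op \<delta> f x = G x / 2" for x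
    by (simp add: L_op_def ext0_eq[OF G])
  with that show ?thesis
    using cg cG df0 dg by (auto simp: L_triple_def)
qed

section \<open>Regularity on the closed half-lines when g vanishes at 0\<close>

lemma Ck_on_reflect:
  assumes "Ck_on k {0..} (\<lambda>x. f (- x))"
  shows "Ck_on k {..0} f"
proof -
  obtain D where D: "\<And>x. x \<ge> 0 \<Longrightarrow> D 0 x = f (- x)"
    "\<And>j x. j < k \<Longrightarrow> x \<ge> 0 \<Longrightarrow> (D j has_real_derivative D (Suc j) x) (at x within {0..})"
    "\<And>j. j \<le> k \<Longrightarrow> continuous_on {0..} (D j)"
    using assms by (auto simp: Ck_on_def)
  define E where "E j x = (-1) ^ j * D j (- x)" for j x
  have "(E j has_real_derivative E (Suc j) x) (at x within {..0})" if "j < k" "x \<le> 0" for j x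
  proof -
    have "uminus ` {..0::real} = {0..}"
      by (auto intro!: image_eqI[where x="- y" for y])
    then have "((\<lambda>x. D j (- x)) has_real_derivative D (Suc j) (- x) * -1) (at x within {..0})"
      using DERIV_image_chain[of "D j" "D (Suc j) (- x)" uminus x "{..0}" "-1"] D(2)[of j "- x"] that
        DERIV_minus[OF DERIV_ident, of x "{..0}"]
      by (simp add: o_def)
    from DERIV_cmult[OF this, of "(-1) ^ j"] show ?thesis
      by (simp add: E_def[abs_def])
  qed
  moreover have "continuous_on {..0} (E j)" if "j \<le> k" for j
    unfolding E_def using that
    by (intro continuous_intros continuous_on_compose2[OF D(3)]) auto
  moreover have "E 0 x = f x" if "x \<le> 0" for x
    using that D(1)[of "- x"] by (simp add: E_def)
  ultimately show ?thesis
    unfolding Ck_on_def by (intro exI[of _ E]) auto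
qed

lemma continuous_on_tendsto_at_right:
  fixes h :: "real \<Rightarrow> real"
  assumes "continuous_on UNIV h"
  shows "(h \<longlongrightarrow> h x) (at_right x)"
  using assms by (simp add: continuous_on_eq_continuous_at isCont_def filterlim_at_split)

text \<open>Here \<open>h\<close> is f' and \<open>H\<close> is f'' on the open half-line. The only
  critical term of \<open>H\<close> is g x^(-\<delta>), and g(0) = 0 gives it a limit at 0. Then
  \<open>H\<close> converges, its limit is the one-sided derivative of f' at 0, and so f'' extends
  continuously.\<close>

lemma L_triple_Ck_on:
  assumes "L_triple \<delta> f g G" "g 0 = 0" "0 \<le> \<delta>" "\<delta> < 1"
  shows "Ck_on 2 {0..} f"
proof -
  note tr = L_tripleD[OF assms(1)]
  have lim: "(g \<longlongrightarrow> 0) (at_right 0)" "(G \<longlongrightarrow> G 0) (at_right 0)"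
    using continuous_on_tendsto_at_right[OF tr(2), of 0] continuous_on_tendsto_at_right[OF tr(3), of 0]
    by (simp_all add: assms(2))
  define h where "h x = g x * \<bar>x\<bar> powr (1 - \<delta>)" for x
  define H where "H x = G x + (1 - \<delta>) * (g x * \<bar>x\<bar> powr (- \<delta>))" for x
  obtain l where l: "((\<lambda>x. g x * \<bar>x\<bar> powr (- \<delta>)) \<longlongrightarrow> l) (at_right 0)"
  proof (cases "\<delta> = 0")
    \<comment> \<open>For \<delta> = 0 the quotient is g itself on the right of 0. At 0 the two
      differ in form, since \<open>0 powr 0 = 0\<close>, hence the eventual equality.\<close>
    case True
    have "\<forall>\<^sub>F x in at_right 0. g x = g x * \<bar>x\<bar> powr (- \<delta>)"
      using eventually_at_right_less[of 0] by eventually_elim (simp add: True)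
    with lim(1) have "((\<lambda>x. g x * \<bar>x\<bar> powr (- \<delta>)) \<longlongrightarrow> 0) (at_right 0)"
      using tendsto_cong by fast
    then show ?thesis by (rule that)
  next
    case False
    then have d: "\<delta> > 0" using assms by simp
    have pos: "\<forall>\<^sub>F x::real in at_right 0. x > 0" by (rule eventually_at_right_less)
    \<comment> \<open>Numerator and denominator both vanish at 0, the former by g(0) = 0. The
      singular factor x^(\<delta>-1) cancels in the quotient of the derivatives, leaving G /
      \<delta>.\<close>
    have "((\<lambda>x. g x / (\<bar>x\<bar> powr \<delta>)) \<longlongrightarrow> G 0 / \<delta>) (at_right 0)"
    proof (rule lhopital_right_0[where f'="\<lambda>x. G x * \<bar>x\<bar> powr (\<delta> - 1)"
            and g'="\<lambda>x. \<delta> * \<bar>x\<bar> powr (\<delta> - 1) * sgn x"])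
      have "continuous_on UNIV (\<lambda>x::real. \<bar>x\<bar> powr \<delta>)"
        using d by (intro continuous_intros) auto
      from continuous_on_tendsto_at_right[OF this, of 0] show "((\<lambda>x::real. \<bar>x\<bar> powr \<delta>) \<longlongrightarrow> 0) (at_right 0)" by simp
      have "((\<lambda>x. G x / \<delta>) \<longlongrightarrow> G 0 / \<delta>) (at_right 0)"
        using d by (intro tendsto_intros lim) auto
      moreover have "\<forall>\<^sub>F x in at_right 0. G x / \<delta>
           = G x * \<bar>x\<bar> powr (\<delta> - 1) / (\<delta> * \<bar>x\<bar> powr (\<delta> - 1) * sgn x)"
        using pos by eventually_elim (simp add: field_simps)
      ultimately show "((\<lambda>x. G x * \<bar>x\<bar> powr (\<delta> - 1) / (\<delta> * \<bar>x\<bar> powr (\<delta> - 1) * sgn x))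
          \<longlongrightarrow> G 0 / \<delta>) (at_right 0)"
        using tendsto_cong by fast
      show "\<forall>\<^sub>F x in at_right 0. (g has_real_derivative G x * \<bar>x\<bar> powr (\<delta> - 1)) (at x)"
        using pos by eventually_elim (rule tr(5), simp)
      show "\<forall>\<^sub>F x in at_right 0. ((\<lambda>x. \<bar>x\<bar> powr \<delta>) has_real_derivative
          \<delta> * \<bar>x\<bar> powr (\<delta> - 1) * sgn x) (at x)"
        using pos by eventually_elim (rule abs_powr_deriv, simp)
      show "\<forall>\<^sub>F x::real in at_right 0. \<bar>x\<bar> powr \<delta> \<noteq> 0"
        using pos by eventually_elim simp
      show "\<forall>\<^sub>F x in at_right 0. \<delta> * \<bar>x\<bar> powr (\<delta> - 1) * sgn x \<noteq> 0"
        using pos by eventually_elim (use d in simp)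
    qed (rule lim)
    then show ?thesis
      by (intro that) (simp add: powr_minus divide_inverse)
  qed
  have dh: "(h has_real_derivative H x) (at x)" if "x > 0" for x
  proof -
    have "(h has_real_derivative G x * \<bar>x\<bar> powr (\<delta> - 1) * \<bar>x\<bar> powr (1 - \<delta>)
        + (1 - \<delta>) * \<bar>x\<bar> powr (1 - \<delta> - 1) * sgn x * g x) (at x)"
      unfolding h_def[abs_def]
      by (intro DERIV_mult tr(5) abs_powr_deriv) (use that in auto)
    then show ?thesis
      by (rule DERIV_cong)
         (use that abs_powr_mult_cancel[of x \<delta>] in \<open>simp add: H_def mult.assoc mult.commute[of "g x"]\<close>)
  qed
  define l' where "l' = G 0 + (1 - \<delta>) * l"
  have Hl: "(H \<longlongrightarrow> l') (at_right 0)"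
    unfolding H_def[abs_def] l'_def by (intro tendsto_intros lim l)
  have ch: "continuous_on UNIV h"
    unfolding h_def using assms by (intro continuous_intros tr) auto
  have h0: "h 0 = 0" by (simp add: h_def)
  \<comment> \<open>A second use of l'Hopital, now with denominator x, turns the limit of f'' into
    the one-sided derivative of f' at 0.\<close>
  have "((\<lambda>x. h x / x) \<longlongrightarrow> l') (at_right 0)"
  proof (rule lhopital_right_0[where f'=H and g'="\<lambda>_. 1"])
    show "(h \<longlongrightarrow> 0) (at_right 0)"
      using continuous_on_tendsto_at_right[OF ch, of 0] by (simp add: h0)
    show "\<forall>\<^sub>F x in at_right 0. (h has_real_derivative H x) (at x)"
      using eventually_at_right_less[of 0] by eventually_elim (rule dh)
    show "\<forall>\<^sub>F x::real in at_right 0. x \<noteq> 0"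
      using eventually_at_right_less[of 0] by eventually_elim simp
  qed (use Hl in \<open>auto intro!: derivative_eq_intros\<close>)
  then have dh0: "(h has_real_derivative l') (at 0 within {0..})"
    by (simp add: has_field_derivative_iff h0 at_within_Ici_at_right)
  \<comment> \<open>At 0 the formula for \<open>H\<close> evaluates to \<open>G 0\<close>, because
    \<open>0 powr a = 0\<close>; this is in general not the limit \<open>l'\<close>.\<close>
  define K where "K x = (if x = 0 then l' else H x)" for x
  have dK: "(h has_real_derivative K x) (at x within {0..})" if "x \<ge> 0" for x
    using dh0 dh[of x] that by (auto simp: K_def intro: has_field_derivative_at_within)
  have cK: "continuous_on {0..} K"
    unfolding continuous_on_eq_continuous_within
  proof
    fix x :: real assume x: "x \<in> {0..}"
    show "continuous (at x within {0..}) K"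
    proof (cases "x = 0")
      case True
      have "\<forall>\<^sub>F x in at_right 0. H x = K x"
        using eventually_at_right_less[of 0] by eventually_elim (simp add: K_def)
      with Hl have "(K \<longlongrightarrow> l') (at_right 0)" using tendsto_cong by fast
      then show ?thesis by (simp add: True continuous_within K_def at_within_Ici_at_right)
    next
      case False
      have "continuous_on {0<..} H"
        unfolding H_def
        by (intro continuous_on_add continuous_on_mult continuous_on_const continuous_on_powr
              continuous_on_rabs continuous_on_id continuous_on_subset[OF tr(2)]
              continuous_on_subset[OF tr(3)]) auto
      then have "isCont H x"
        using x False by (simp add: continuous_on_eq_continuous_at)
      moreover have "\<forall>\<^sub>F y in nhds x. H y = K y"
        using t1_space_nhds[OF False] by eventually_elim (simp add: K_def)
      ultimately have "isCont K x" using isCont_cong by blast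
      then show ?thesis by (rule continuous_at_imp_continuous_at_within)
    qed
  qed
  have df: "(f has_real_derivative h x) (at x within {0..})" for x
    using tr(4)[of x] by (auto simp: h_def intro: has_field_derivative_at_within)
  show ?thesis
    unfolding Ck_on_def
  proof (intro exI[of _ "\<lambda>j. if j = 0 then f else if j = 1 then h else K"] conjI ballI allI impI)
    fix j :: nat and x :: real assume "j < 2" "x \<in> {0..}"
    then have "j = 0 \<or> j = 1" by auto
    then show "((if j = 0 then f else if j = 1 then h else K) has_real_derivative
       (if Suc j = 0 then f else if Suc j = 1 then h else K) x) (at x within {0..})"
      using df dK \<open>x \<in> {0..}\<close> by auto
  qed (use ch cK tr(1) in \<open>auto intro: continuous_on_subset\<close>)
qed

text \<open>Together with the passage from the extended domain to triples, this confines the domain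
  definitions to the two ends of the argument: everything between is done with triples. Continuous
  extensions being unique, \<open>g\<close> and \<open>G\<close> are the ones that
  \<open>L_op\<close> selects.\<close>

lemma L_triple_dom_L:
  assumes tr: "L_triple \<delta> f g G" "g 0 = 0" and "0 \<le> \<delta>" "\<delta> < 1"
  shows "f \<in> dom_L \<delta>" "L_op \<delta> f x = G x / 2"
proof -
  note tr' = L_tripleD[OF tr(1)]
  have g: "continuous_extension (scaled_deriv \<delta> f) g"
    using tr'(2) DERIV_imp_deriv[OF tr'(4)]
    by (simp add: continuous_extension_def scaled_deriv_def mult.assoc abs_powr_mult_cancel)
  have G: "continuous_extension (scaled_deriv2 \<delta> f) G"
    using tr'(3) DERIV_imp_deriv[OF tr'(5)]
    by (simp add: continuous_extension_def scaled_deriv2_def ext0_eq[OF g] mult.assoc abs_powr_mult_cancel)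
  have "Ck_on 2 {..0} f"
    by (rule Ck_on_reflect, rule L_triple_Ck_on[OF L_triple_reflect[OF tr(1)]]) (use assms in auto)
  moreover have "Ck_on 2 {0..} f"
    by (rule L_triple_Ck_on[OF tr(1)]) (use assms in auto)
  ultimately show "f \<in> dom_L \<delta>"
    using g G tr'(1) by (auto simp: dom_L_def admissible_def)
  show "L_op \<delta> f x = G x / 2"
    by (simp add: L_op_def ext0_eq[OF G])
qed

section \<open>Truncation and the spike\<close>

lemma bounded_deriv_support_bound:
  fixes F h :: "real \<Rightarrow> real"
  assumes F: "\<And>x. (F has_real_derivative h x) (at x)"
    and "\<And>x. \<bar>x\<bar> \<le> r \<Longrightarrow> \<bar>h x\<bar> \<le> B" "\<And>x. \<bar>x\<bar> \<ge> r \<Longrightarrow> h x = 0" "0 \<le> r"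
  shows "\<bar>F x - F 0\<bar> \<le> B * r"
proof -
  have near: "\<bar>F y - F 0\<bar> \<le> B * r" if "\<bar>y\<bar> \<le> r" for y
  proof -
    have "norm (F y - F 0) \<le> B * norm (y - 0)"
      by (rule field_differentiable_bound[where S="{-r..r}" and f'=h])
         (use assms that in \<open>auto intro: has_field_derivative_at_within\<close>)
    also have "\<dots> \<le> B * r"
      using that assms(2)[of 0] \<open>0 \<le> r\<close> by (intro mult_left_mono) auto
    finally show ?thesis by simp
  qed
  \<comment> \<open>Beyond r the derivative vanishes, so F is constant on each outer half-line and
    inherits the bound from the endpoint.\<close>
  have const: "F y = F z"
    if S: "convex S" "\<And>x. x \<in> S \<Longrightarrow> r \<le> \<bar>x\<bar>" and yz: "y \<in> S" "z \<in> S" for S y z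
  proof -
    have "(F has_real_derivative 0) (at x within S)" if "x \<in> S" for x
      using F[of x] assms(3)[OF S(2)[OF that]] by (simp add: has_field_derivative_at_within)
    then obtain c where "\<forall>x\<in>S. F x = c"
      using has_field_derivative_zero_constant[OF S(1)] by blast
    then show ?thesis using yz by simp
  qed
  consider "\<bar>x\<bar> \<le> r" | "x \<ge> r" | "x \<le> - r" by linarith
  then show ?thesis
  proof cases
    case 2
    then show ?thesis using const[of "{r..}" x r] near[of r] \<open>0 \<le> r\<close> by auto
  next
    case 3
    then show ?thesis using const[of "{..-r}" x "-r"] near[of "-r"] \<open>0 \<le> r\<close> by auto
  qed (rule near)
qed

text \<open>Cutting off in the square of x instead of |x| keeps the weight smooth enough at 0. The
  pair (a, b) is (1, R^2) for the truncation and (m^2, 0) for the spike. A weight of class C^1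
  suffices, since only its first derivative enters G.\<close>

lemma cutoff_poly_deriv:
  "((\<lambda>x. cutoff (a * x\<^sup>2 - b)) has_real_derivative 2 * a * x * cutoff' (a * x\<^sup>2 - b)) (at x)"
proof -
  have "((\<lambda>x. a * x\<^sup>2 - b) has_real_derivative 2 * a * x) (at x)"
    by (auto intro!: derivative_eq_intros)
  from DERIV_chain2[OF cutoff_deriv this] show ?thesis by (simp add: mult_ac)
qed

lemma continuous_bounded_on_ball:
  fixes h :: "real \<Rightarrow> real"
  assumes "continuous_on UNIV h"
  obtains B where "\<And>x. \<bar>x\<bar> \<le> r \<Longrightarrow> \<bar>h x\<bar> \<le> B"
proof -
  have "compact (h ` {-r..r})"
    by (intro compact_continuous_image continuous_on_subset[OF assms]) auto
  then obtain B where "\<forall>y\<in>h ` {-r..r}. norm y \<le> B"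
    using compact_imp_bounded bounded_iff by metis
  then show ?thesis by (intro that[of B]) (simp add: abs_le_iff)
qed

text \<open>The weight multiplies g and not f: the result is again a triple by the product rule
  alone, and its first component is the antiderivative with the same value at 0. It is constant, not
  zero, on each side beyond R + 1, which is enough for boundedness.\<close>

lemma L_triple_truncate:
  assumes tr: "L_triple \<delta> f g G" and "\<delta> < 1" "0 \<le> R"
  obtains fR gR GR C where "L_triple \<delta> fR gR GR"
    "\<And>x. \<bar>x\<bar> \<le> R \<Longrightarrow> fR x = f x" "\<And>x. \<bar>x\<bar> \<le> R \<Longrightarrow> GR x = G x"
    "\<And>x. \<bar>fR x\<bar> \<le> C" "\<And>x. \<bar>GR x\<bar> \<le> C"
proof -
  note tr' = L_tripleD[OF tr]
  define \<eta> where "\<eta> x = cutoff (1 * x\<^sup>2 - R\<^sup>2)" for x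
  define \<eta>' where "\<eta>' x = 2 * 1 * x * cutoff' (1 * x\<^sup>2 - R\<^sup>2)" for x
  have d\<eta>: "(\<eta> has_real_derivative \<eta>' x) (at x)" for x
    unfolding \<eta>_def[abs_def] \<eta>'_def by (rule cutoff_poly_deriv)
  have c\<eta>: "continuous_on UNIV \<eta>" "continuous_on UNIV \<eta>'"
    unfolding \<eta>_def \<eta>'_def by (intro continuous_intros)+
  have inner: "\<eta> x = 1" "\<eta>' x = 0" if "\<bar>x\<bar> \<le> R" for x
    using that abs_le_square_iff[of x R] \<open>0 \<le> R\<close> by (auto simp: \<eta>_def \<eta>'_def cutoff_simps)
  \<comment> \<open>The weight is 0 once x^2 - R^2 >= 1, and (R + 1)^2 >= R^2 + 1.\<close>
  have outer: "\<eta> x = 0" "\<eta>' x = 0" if "\<bar>x\<bar> \<ge> R + 1" for x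
  proof -
    have "R\<^sup>2 + 1 \<le> (R + 1)\<^sup>2" using \<open>0 \<le> R\<close> by (simp add: power2_eq_square algebra_simps)
    also have "\<dots> \<le> x\<^sup>2" using that abs_le_square_iff[of "R + 1" x] \<open>0 \<le> R\<close> by simp
    finally show "\<eta> x = 0" "\<eta>' x = 0" by (simp_all add: \<eta>_def \<eta>'_def cutoff_simps)
  qed
  define gR where "gR x = g x * \<eta> x" for x
  \<comment> \<open>The product rule yields g \<eta>', and the factor |x|^(1-\<delta>) is the
    scaling of condition (b).\<close>
  define GR where "GR x = G x * \<eta> x + g x * \<eta>' x * \<bar>x\<bar> powr (1 - \<delta>)" for x
  have cgR: "continuous_on UNIV gR" unfolding gR_def by (intro continuous_intros tr' c\<eta>)
  have cGR: "continuous_on UNIV GR"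
    unfolding GR_def using \<open>\<delta> < 1\<close> by (intro continuous_intros tr' c\<eta>) auto
  have chR: "continuous_on UNIV (\<lambda>x. gR x * \<bar>x\<bar> powr (1 - \<delta>))"
    using \<open>\<delta> < 1\<close> by (intro continuous_intros cgR) auto
  then obtain fR where fR: "fR 0 = f 0" "\<And>x. (fR has_real_derivative gR x * \<bar>x\<bar> powr (1 - \<delta>)) (at x)"
    by (rule ex_antiderivative[where c="f 0"]) blast
  have "L_triple \<delta> fR gR GR"
    unfolding L_triple_def
  proof (intro conjI allI impI cgR cGR fR)
    fix x :: real assume x: "x \<noteq> 0"
    show "(gR has_real_derivative GR x * \<bar>x\<bar> powr (\<delta> - 1)) (at x)"
      unfolding gR_def[abs_def]
      by (rule DERIV_cong[OF DERIV_mult[OF tr'(5)[OF x] d\<eta>]])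
         (simp add: GR_def algebra_simps abs_powr_mult_cancel[OF x])
  qed
  moreover have "fR x = f x" if x: "\<bar>x\<bar> \<le> R" for x
  proof -
    have "\<exists>c. \<forall>y\<in>{-R..R}. fR y - f y = c"
    proof (rule has_field_derivative_zero_constant)
      fix y assume "y \<in> {-R..R}"
      then have "gR y = g y" using inner[of y] by (simp add: gR_def abs_le_iff)
      then show "((\<lambda>y. fR y - f y) has_real_derivative 0) (at y within {-R..R})"
        using DERIV_diff[OF fR(2)[of y] tr'(4)[of y]] by (simp add: has_field_derivative_at_within)
    qed auto
    then have "fR x - f x = fR 0 - f 0"
      using x \<open>0 \<le> R\<close> by (metis abs_le_iff abs_zero atLeastAtMost_iff minus_le_iff)
    then show ?thesis using fR(1) by simp
  qed
  moreover have "GR x = G x" if "\<bar>x\<bar> \<le> R" for x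
    using inner[OF that] by (simp add: GR_def)
  moreover obtain C1 where C1: "\<And>x. \<bar>fR x\<bar> \<le> C1"
  proof -
    obtain B where B: "\<And>x. \<bar>x\<bar> \<le> R + 1 \<Longrightarrow> \<bar>gR x * \<bar>x\<bar> powr (1 - \<delta>)\<bar> \<le> B"
      using continuous_bounded_on_ball[OF chR] by blast
    have "\<bar>fR x - fR 0\<bar> \<le> B * (R + 1)" for x
      by (rule bounded_deriv_support_bound[OF fR(2) B]) (use outer \<open>0 \<le> R\<close> in \<open>auto simp: gR_def\<close>)
    then have "\<bar>fR x\<bar> \<le> B * (R + 1) + \<bar>fR 0\<bar>" for x
      using abs_triangle_ineq2[of "fR x" "fR 0"] by (smt (verit))
    then show ?thesis by (rule that)
  qed
  moreover obtain C2 where C2: "\<And>x. \<bar>GR x\<bar> \<le> C2"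
  proof -
    obtain B where B: "\<And>x. \<bar>x\<bar> \<le> R + 1 \<Longrightarrow> \<bar>GR x\<bar> \<le> B"
      using continuous_bounded_on_ball[OF cGR] by blast
    have "\<bar>GR x\<bar> \<le> max B 0" for x
      by (cases "\<bar>x\<bar> \<le> R + 1") (use B[of x] outer[of x] in \<open>auto simp: GR_def\<close>)
    then show ?thesis by (rule that)
  qed
  ultimately show ?thesis
    by (intro that[of fR gR GR "max C1 C2"]) (auto simp: le_max_iff_disj)
qed

text \<open>The derivative of k is at most 1 in size and lives on [-1/m, 1/m], whence the bound 1/m.
  In the bound for K the factor |x|^(1-\<delta>) is kept, because it is the weight that hypothesis
  (ii) controls.\<close>

lemma L_triple_spike:
  assumes "0 \<le> \<delta>" "\<delta> < 1" "1 \<le> m"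
  obtains k \<zeta> K where "L_triple \<delta> k \<zeta> K" "\<zeta> 0 = 1"
    "\<And>x. \<bar>k x\<bar> \<le> 1 / m"
    "\<And>x. \<bar>K x\<bar> \<le> 8 * m * \<bar>x\<bar> powr (1 - \<delta>) * indicator {-1/m..1/m} x"
proof -
  define \<zeta> where "\<zeta> x = cutoff (m\<^sup>2 * x\<^sup>2 - 0)" for x
  define \<zeta>' where "\<zeta>' x = 2 * m\<^sup>2 * x * cutoff' (m\<^sup>2 * x\<^sup>2 - 0)" for x
  define K where "K x = \<zeta>' x * \<bar>x\<bar> powr (1 - \<delta>)" for x
  have d\<zeta>: "(\<zeta> has_real_derivative \<zeta>' x) (at x)" for x
    unfolding \<zeta>_def[abs_def] \<zeta>'_def by (rule cutoff_poly_deriv)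
  have c\<zeta>: "continuous_on UNIV \<zeta>" "continuous_on UNIV \<zeta>'"
    unfolding \<zeta>_def \<zeta>'_def by (intro continuous_intros)+
  have cK: "continuous_on UNIV K"
    unfolding K_def using assms by (intro continuous_intros c\<zeta>) auto
  have "continuous_on UNIV (\<lambda>x. \<zeta> x * \<bar>x\<bar> powr (1 - \<delta>))"
    using assms by (intro continuous_intros c\<zeta>) auto
  then obtain k where k: "k 0 = 0" "\<And>x. (k has_real_derivative \<zeta> x * \<bar>x\<bar> powr (1 - \<delta>)) (at x)"
    by (rule ex_antiderivative[where c=0]) blast
  have outer: "\<zeta> x = 0" "\<zeta>' x = 0" if "\<bar>x\<bar> \<ge> 1 / m" for x
  proof -
    have "1 \<le> \<bar>m * x\<bar>" using that assms by (simp add: field_simps abs_mult)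
    then have "1 \<le> m\<^sup>2 * x\<^sup>2" using abs_le_square_iff[of 1 "m * x"] by (simp add: power_mult_distrib)
    then show "\<zeta> x = 0" "\<zeta>' x = 0" by (simp_all add: \<zeta>_def \<zeta>'_def cutoff_simps)
  qed
  have "L_triple \<delta> k \<zeta> K"
    unfolding L_triple_def
  proof (intro conjI allI impI c\<zeta> cK k)
    show "(\<zeta> has_real_derivative K x * \<bar>x\<bar> powr (\<delta> - 1)) (at x)" if "x \<noteq> 0" for x
      using d\<zeta>[of x] by (simp add: K_def mult.assoc abs_powr_mult_cancel[OF that])
  qed
  moreover have "\<zeta> 0 = 1" by (simp add: \<zeta>_def cutoff_simps)
  moreover have "\<bar>k x\<bar> \<le> 1 / m" for x
  proof -
    have "\<bar>k x - k 0\<bar> \<le> 1 * (1 / m)"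
    proof (rule bounded_deriv_support_bound[OF k(2)])
      fix x :: real assume "\<bar>x\<bar> \<le> 1 / m"
      also have "\<dots> \<le> 1" using assms by simp
      finally have "\<bar>x\<bar> powr (1 - \<delta>) \<le> 1" using assms by (intro powr_le1) auto
      then have "\<zeta> x * \<bar>x\<bar> powr (1 - \<delta>) \<le> 1"
        using cutoff_bounds(1,2) by (intro mult_le_one) (auto simp: \<zeta>_def)
      then show "\<bar>\<zeta> x * \<bar>x\<bar> powr (1 - \<delta>)\<bar> \<le> 1"
        using cutoff_bounds(1) by (simp add: \<zeta>_def abs_mult)
    qed (use outer assms in auto)
    then show ?thesis using k(1) by simp
  qed
  moreover have "\<bar>K x\<bar> \<le> 8 * m * \<bar>x\<bar> powr (1 - \<delta>) * indicator {-1/m..1/m} x" for x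
  proof (cases "\<bar>x\<bar> \<le> 1 / m")
    case True
    \<comment> \<open>One of the two factors m is absorbed by m |x| <= 1; with 4 bounding
      \<open>cutoff'\<close> this gives 8 m.\<close>
    have "\<bar>\<zeta>' x\<bar> = 2 * (m * (m * \<bar>x\<bar>)) * \<bar>cutoff' (m\<^sup>2 * x\<^sup>2 - 0)\<bar>"
      by (simp add: \<zeta>'_def abs_mult power2_eq_square)
    also have "\<dots> \<le> 2 * (m * 1) * 4"
      using True assms cutoff_bounds(3) by (intro mult_mono) (auto simp: field_simps)
    finally have "\<bar>\<zeta>' x\<bar> \<le> 8 * m" by simp
    moreover have "x \<in> {-1/m..1/m}" using True by auto
    ultimately show ?thesis
      by (simp add: K_def abs_mult mult_right_mono)
  next
    case False
    then have "x \<notin> {-1/m..1/m}" by auto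
    then show ?thesis using False outer(2)[of x] by (simp add: K_def)
  qed
  ultimately show ?thesis by (rule that)
qed

section \<open>Martingales and stopping\<close>

text \<open>Conditional expectations are replaced by integrals over events of the past, which pass
  to limits and split over sums.\<close>

lemma (in prob_space) martingale_uptoI:
  assumes sub: "\<And>t. subalgebra M (F t)"
    and ad: "\<And>t. t \<in> {0..T} \<Longrightarrow> Y t \<in> borel_measurable (F t)"
    and int: "\<And>t. t \<in> {0..T} \<Longrightarrow> integrable M (Y t)"
    and eq: "\<And>s t A. 0 \<le> s \<Longrightarrow> s \<le> t \<Longrightarrow> t \<le> T \<Longrightarrow> A \<in> sets (F s) \<Longrightarrow>
       (LINT \<omega>:A|M. Y t \<omega>) = (LINT \<omega>:A|M. Y s \<omega>)"
  shows "martingale_upto M F T Y"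
  unfolding martingale_upto_def
proof (intro conjI ballI ad int)
  fix s t assume st: "s \<in> {0..T}" "t \<in> {s..T}"
  interpret finite_measure_subalgebra M "F s"
    by (rule finite_measure_subalgebra.intro, rule finite_measure_axioms)
       (rule finite_measure_subalgebra_axioms.intro, rule sub)
  show "AE \<omega> in M. real_cond_exp M (F s) (Y t) \<omega> = Y s \<omega>"
  proof (rule real_cond_exp_charact)
    show "(LINT \<omega>:A|M. Y t \<omega>) = (LINT \<omega>:A|M. Y s \<omega>)" if "A \<in> sets (F s)" for A
      by (rule eq) (use st that in auto)
    show "integrable M (Y t)" "integrable M (Y s)" by (rule int; use st in simp)+
    show "Y s \<in> borel_measurable (F s)" by (rule ad[OF st(1)])
  qed
qed

lemma (in prob_space) martingale_upto_boundedI: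
  assumes sub: "\<And>t. subalgebra M (F t)"
    and ad: "\<And>t. t \<in> {0..T} \<Longrightarrow> Y t \<in> borel_measurable (F t)"
    and bd: "\<And>t \<omega>. t \<in> {0..T} \<Longrightarrow> \<omega> \<in> space M \<Longrightarrow> \<bar>Y t \<omega>\<bar> \<le> C"
    and eq: "\<And>s t A. 0 \<le> s \<Longrightarrow> s \<le> t \<Longrightarrow> t \<le> T \<Longrightarrow> A \<in> sets (F s) \<Longrightarrow>
       (LINT \<omega>:A|M. Y t \<omega>) = (LINT \<omega>:A|M. Y s \<omega>)"
  shows "martingale_upto M F T Y"
proof (rule martingale_uptoI[OF sub ad _ eq])
  show "integrable M (Y t)" if "t \<in> {0..T}" for t
    using bd[OF that] measurable_from_subalg[OF sub ad[OF that]]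
    by (intro integrable_const_bound[of _ C]) auto
qed

lemma (in prob_space) martingale_upto_set_integral:
  assumes "martingale_upto M F T Y" "subalgebra M (F s)"
    and "0 \<le> s" "s \<le> t" "t \<le> T" "A \<in> sets (F s)"
  shows "(LINT \<omega>:A|M. Y t \<omega>) = (LINT \<omega>:A|M. Y s \<omega>)"
proof -
  interpret finite_measure_subalgebra M "F s"
    by (rule finite_measure_subalgebra.intro, rule finite_measure_axioms)
       (rule finite_measure_subalgebra_axioms.intro, rule assms)
  have int: "integrable M (Y t)"
    and ae: "AE \<omega> in M. real_cond_exp M (F s) (Y t) \<omega> = Y s \<omega>"
    and m: "Y s \<in> borel_measurable (F s)"
    using assms by (auto simp: martingale_upto_def)
  have "(LINT \<omega>:A|M. Y t \<omega>) = (LINT \<omega>:A|M. real_cond_exp M (F s) (Y t) \<omega>)"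
    by (rule real_cond_exp_intA[OF int assms(6)])
  also have "\<dots> = (LINT \<omega>:A|M. Y s \<omega>)"
  proof (rule set_lebesgue_integral_cong_AE)
    show "A \<in> sets M" using assms(2,6) by (auto simp: subalgebra_def)
    show "Y s \<in> borel_measurable M" by (rule measurable_from_subalg[OF assms(2) m])
  qed (use ae in auto)
  finally show ?thesis .
qed

lemma (in prob_space) martingale_upto_cong:
  assumes Y: "martingale_upto M F T Y" and sub: "\<And>t. subalgebra M (F t)"
    and eq: "\<And>t \<omega>. t \<in> {0..T} \<Longrightarrow> \<omega> \<in> space M \<Longrightarrow> Y t \<omega> = Z t \<omega>"
  shows "martingale_upto M F T Z"
proof (rule martingale_uptoI[OF sub])
  have spF: "space (F t) = space M" for t using sub[of t] by (simp add: subalgebra_def)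
  show "Z t \<in> borel_measurable (F t)" if "t \<in> {0..T}" for t
    using Y that measurable_cong[of "F t" "Y t" "Z t" borel] eq[OF that]
    by (auto simp: martingale_upto_def spF)
  show "integrable M (Z t)" if "t \<in> {0..T}" for t
    using Y that Bochner_Integration.integrable_cong[of M M "Y t" "Z t"] eq[OF that]
    by (auto simp: martingale_upto_def)
  fix s t A assume st: "0 \<le> s" "s \<le> t" "t \<le> T" and A: "A \<in> sets (F s)"
  have "A \<in> sets M" using sub[of s] A by (auto simp: subalgebra_def)
  then have ZY: "(LINT \<omega>:A|M. Z r \<omega>) = (LINT \<omega>:A|M. Y r \<omega>)" if "r \<in> {0..T}" for r
    using sets.sets_into_space[of A M] eq[OF that] by (intro set_lebesgue_integral_cong) auto
  show "(LINT \<omega>:A|M. Z t \<omega>) = (LINT \<omega>:A|M. Z s \<omega>)"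
    using martingale_upto_set_integral[OF Y sub st A] st by (simp add: ZY)
qed

lemma (in prob_space) set_integral_bounded_limit:
  fixes Z :: "nat \<Rightarrow> 'a \<Rightarrow> real"
  assumes "A \<in> sets M" "\<And>n. Z n \<in> borel_measurable M" "Z' \<in> borel_measurable M"
    and "AE \<omega> in M. (\<lambda>n. Z n \<omega>) \<longlonglongrightarrow> Z' \<omega>"
    and "\<And>n \<omega>. \<omega> \<in> space M \<Longrightarrow> \<bar>Z n \<omega>\<bar> \<le> C"
  shows "(\<lambda>n. LINT \<omega>:A|M. Z n \<omega>) \<longlonglongrightarrow> (LINT \<omega>:A|M. Z' \<omega>)"
  unfolding set_lebesgue_integral_def
proof (rule integral_dominated_convergence[where w="\<lambda>_. C"])
  show "AE \<omega> in M. (\<lambda>n. indicat_real A \<omega> *\<^sub>R Z n \<omega>) \<longlonglongrightarrow> indicat_real A \<omega> *\<^sub>R Z' \<omega>"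
    using assms(4) by eventually_elim (intro tendsto_intros)
  show "AE \<omega> in M. norm (indicat_real A \<omega> *\<^sub>R Z n \<omega>) \<le> C" for n
  proof (rule AE_I2)
    fix \<omega> assume "\<omega> \<in> space M"
    from assms(5)[OF this, of n] show "norm (indicat_real A \<omega> *\<^sub>R Z n \<omega>) \<le> C"
      by (auto simp: indicator_def)
  qed
qed (use assms in auto)

text \<open>The localizing times reach T after finitely many steps, so for almost every outcome the
  stopped value is eventually equal to \<open>Y t\<close>. Dominated convergence with the constant C
  does the rest.\<close>

lemma (in prob_space) bounded_local_martingale_upto:
  assumes sub: "\<And>t. subalgebra M (F t)"
    and Y: "local_martingale_upto M F T Y"
    and bd: "\<And>t \<omega>. t \<in> {0..T} \<Longrightarrow> \<omega> \<in> space M \<Longrightarrow> \<bar>Y t \<omega>\<bar> \<le> C"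
  shows "martingale_upto M F T Y"
proof -
  obtain \<tau> :: "nat \<Rightarrow> 'a \<Rightarrow> real" where
    \<tau>: "\<And>n \<omega>. \<omega> \<in> space M \<Longrightarrow> \<tau> n \<omega> \<in> {0..T}"
    and inc: "AE \<omega> in M. incseq (\<lambda>n. \<tau> n \<omega>) \<and> (\<exists>n. \<tau> n \<omega> = T)"
    and mart: "\<And>n. martingale_upto M F T (\<lambda>t \<omega>. Y (min t (\<tau> n \<omega>)) \<omega>)"
    using Y unfolding local_martingale_upto_def by blast
  have ad: "Y t \<in> borel_measurable (F t)" if "t \<in> {0..T}" for t
    using Y that by (auto simp: local_martingale_upto_def)
  have lim: "(\<lambda>n. LINT \<omega>:A|M. Y (min t (\<tau> n \<omega>)) \<omega>) \<longlonglongrightarrow> (LINT \<omega>:A|M. Y t \<omega>)"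
    if t: "t \<in> {0..T}" and A: "A \<in> sets M" for t A
  proof (rule set_integral_bounded_limit[OF A])
    show "(\<lambda>\<omega>. Y (min t (\<tau> n \<omega>)) \<omega>) \<in> borel_measurable M" for n
      using mart[of n] t by (auto simp: martingale_upto_def intro: measurable_from_subalg[OF sub])
    show "Y t \<in> borel_measurable M" by (rule measurable_from_subalg[OF sub ad[OF t]])
    show "AE \<omega> in M. (\<lambda>n. Y (min t (\<tau> n \<omega>)) \<omega>) \<longlonglongrightarrow> Y t \<omega>"
      using inc
    proof eventually_elim
      case (elim \<omega>)
      then obtain N where N: "\<tau> N \<omega> = T" by blast
      have "\<forall>\<^sub>F n in sequentially. Y (min t (\<tau> n \<omega>)) \<omega> = Y t \<omega>"
        using eventually_ge_at_top[of N]
      proof eventually_elim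
        case (elim n)
        then have "T \<le> \<tau> n \<omega>" using \<open>incseq _ \<and> _\<close> N by (metis incseqD)
        then show ?case using t by (simp add: min_def)
      qed
      then show ?case by (rule tendsto_eventually)
    qed
    show "\<bar>Y (min t (\<tau> n \<omega>)) \<omega>\<bar> \<le> C" if "\<omega> \<in> space M" for n \<omega>
      using t \<tau>[OF that, of n] by (intro bd that) auto
  qed
  show ?thesis
  proof (rule martingale_upto_boundedI[OF sub ad bd])
    fix s t A assume st: "0 \<le> s" "s \<le> t" "t \<le> T" and A: "A \<in> sets (F s)"
    have "A \<in> sets M" using sub[of s] A by (auto simp: subalgebra_def)
    moreover have "(LINT \<omega>:A|M. Y (min t (\<tau> n \<omega>)) \<omega>) = (LINT \<omega>:A|M. Y (min s (\<tau> n \<omega>)) \<omega>)" for n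
      by (rule martingale_upto_set_integral[OF mart sub st A])
    ultimately show "(LINT \<omega>:A|M. Y t \<omega>) = (LINT \<omega>:A|M. Y s \<omega>)"
      using lim[of t A] lim[of s A] st by (simp add: LIMSEQ_unique)
  qed auto
qed

text \<open>As u is monotone, the indices with u i < r form an initial segment, and the sum
  telescopes over it. This is stopping in discrete time: N is the first index at which u has reached
  r, or k.\<close>

lemma stopped_increment_sum:
  fixes y :: "nat \<Rightarrow> 'b::ab_group_add" and u :: "nat \<Rightarrow> 'c::linorder"
  assumes "incseq u"
  shows "\<exists>N\<le>k. (\<forall>i<N. u i < r) \<and> (N < k \<longrightarrow> r \<le> u N) \<and>
    (\<Sum>i<k. if u i < r then y (Suc i) - y i else 0) = y N - y 0"
proof (induction k)
  case (Suc k)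
  then obtain N where N: "N \<le> k" "\<forall>i<N. u i < r" "N < k \<longrightarrow> r \<le> u N"
    "(\<Sum>i<k. if u i < r then y (Suc i) - y i else 0) = y N - y 0" by blast
  show ?case
  proof (cases "N = k \<and> u k < r")
    case True
    then show ?thesis using N by (intro exI[of _ "Suc k"]) (auto simp: less_Suc_eq)
  next
    case False
    then have "r \<le> u k"
      using N(1,3) incseqD[OF assms N(1)] by force
    then show ?thesis using N False by (intro exI[of _ N]) (auto simp: not_less)
  qed
qed auto

text \<open>The stopped increment is a limit of the sums of \<open>1{t\<^sub>i < \<tau>} (Y t\<^sub>i\<^sub>+\<^sub>1 - Y t\<^sub>i)\<close> over
  equidistant partitions, each of which has mean zero on \<open>A\<close>.\<close>

lemma (in prob_space) martingale_upto_stopped: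
  assumes sub: "\<And>t. subalgebra M (F t)"
    and mono: "\<And>s t. s \<le> t \<Longrightarrow> sets (F s) \<subseteq> sets (F t)"
    and Y: "martingale_upto M F T Y"
    and bd: "\<And>t \<omega>. t \<in> {0..T} \<Longrightarrow> \<omega> \<in> space M \<Longrightarrow> \<bar>Y t \<omega>\<bar> \<le> C"
    and cont: "\<And>\<omega>. \<omega> \<in> space M \<Longrightarrow> continuous_on {0..T} (\<lambda>t. Y t \<omega>)"
    and st: "stopping_time F \<tau>"
    and \<tau>: "\<And>\<omega>. \<omega> \<in> space M \<Longrightarrow> \<tau> \<omega> \<in> {0..T}"
  shows "martingale_upto M F T (\<lambda>t \<omega>. Y (min t (\<tau> \<omega>)) \<omega>)"
proof -
  have spF: "space (F t) = space M" for t using sub[of t] by (simp add: subalgebra_def)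
  have ad: "Y t \<in> borel_measurable (F t)" if "t \<in> {0..T}" for t
    using Y that by (auto simp: martingale_upto_def)
  have up: "h \<in> borel_measurable (F t)" if "h \<in> borel_measurable (F s)" "s \<le> t" for h :: "'a \<Rightarrow> real" and s t
    using that mono[of s t] by (intro measurable_from_subalg[of "F t" "F s"]) (auto simp: subalgebra_def spF)
  have yM: "Y t \<in> borel_measurable M" if "t \<in> {0..T}" for t
    by (rule measurable_from_subalg[OF sub ad[OF that]])
  have before: "{\<omega>\<in>space M. t < \<tau> \<omega>} \<in> sets (F t)" for t
    using stopping_timeD2[OF st, of t] by (simp add: pred_def spF)
  \<comment> \<open>The mesh is (t - s) / (k + 1); the successor keeps the divisor positive.\<close>
  define u where "u s t k i = s + real i * ((t - s) / real (Suc k))" for s t :: real and k i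
  define Z where "Z s t k \<omega> = (\<Sum>i<Suc k. if u s t k i < \<tau> \<omega>
      then Y (u s t k (Suc i)) \<omega> - Y (u s t k i) \<omega> else 0)" for s t k \<omega>
  have u_end: "u s t k 0 = s" "u s t k (Suc k) = t" for s t k
    by (simp_all add: u_def field_simps)
  have u_inc: "incseq (u s t k)" if "s \<le> t" for s t k
    unfolding u_def using that by (intro monoI add_left_mono mult_right_mono) auto
  have u_ge: "s \<le> u s t k i" if "s \<le> t" for s t k i
    using that by (simp add: u_def)
  have u_le: "u s t k i \<le> t" if "s \<le> t" "i \<le> Suc k" for s t k i
    using incseqD[OF u_inc[OF that(1)] that(2)] u_end by metis
  have Z_lim: "(\<lambda>k. Z s t k \<omega>) \<longlonglongrightarrow> Y (min t (\<tau> \<omega>)) \<omega> - Y (min s (\<tau> \<omega>)) \<omega>"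
    and Z_bd: "\<bar>Z s t k \<omega>\<bar> \<le> 2 * C"
    if w: "\<omega> \<in> space M" and s: "0 \<le> s" "s \<le> t" "t \<le> T" for s t \<omega> k
  proof -
    have "\<exists>N\<le>Suc k. (\<forall>i<N. u s t k i < \<tau> \<omega>) \<and> (N < Suc k \<longrightarrow> \<tau> \<omega> \<le> u s t k N) \<and>
      Z s t k \<omega> = Y (u s t k N) \<omega> - Y (u s t k 0) \<omega>" for k
      unfolding Z_def by (rule stopped_increment_sum[OF u_inc[OF s(2)]])
    then obtain N where N: "\<And>k. N k \<le> Suc k" "\<And>k i. i < N k \<Longrightarrow> u s t k i < \<tau> \<omega>"
      "\<And>k. N k < Suc k \<Longrightarrow> \<tau> \<omega> \<le> u s t k (N k)"
      "\<And>k. Z s t k \<omega> = Y (u s t k (N k)) \<omega> - Y s \<omega>"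
      unfolding u_end by metis
    define v where "v k = u s t k (N k)" for k
    have v: "s \<le> v k" "v k \<le> t" for k
      unfolding v_def by (intro u_ge u_le s N(1))+
    show "\<bar>Z s t k \<omega>\<bar> \<le> 2 * C"
      using bd[OF _ w, of "v k"] bd[OF _ w, of s] v[of k] s by (simp add: N(4) v_def[symmetric])
    \<comment> \<open>The stopping time clipped to [s, t]. The grid point \<open>v k\<close> at
      which the sum stops exceeds it by at most one mesh.\<close>
    define m where "m = max s (min t (\<tau> \<omega>))"
    have close: "\<bar>v k - m\<bar> \<le> (t - s) / real (Suc k)" for k
    proof (cases "N k")
      case 0
      then have "\<tau> \<omega> \<le> s" using N(3)[of k] by (simp add: u_end)
      then have "m = s" using s by (auto simp: m_def)
      then show ?thesis using 0 s by (simp add: v_def u_end)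
    next
      case (Suc i)
      have i: "u s t k i < \<tau> \<omega>" using N(2)[of i k] Suc by simp
      have vi: "v k = u s t k i + (t - s) / real (Suc k)"
      proof -
        have "x + (1 + y) * c = x + y * c + c" for x y c :: real by (simp add: algebra_simps)
        then show ?thesis by (simp only: v_def u_def Suc of_nat_Suc)
      qed
      have "u s t k i \<le> t" using N(1)[of k] Suc by (intro u_le s) simp
      then have "u s t k i \<le> m" using i by (auto simp: m_def)
      moreover have "m \<le> v k"
      proof (cases "N k = Suc k")
        case True
        then have "v k = t" by (simp add: v_def u_end)
        then show ?thesis using s by (simp add: m_def)
      next
        case False
        then have "\<tau> \<omega> \<le> v k" using N(1,3)[of k] by (simp add: v_def)
        then show ?thesis using v[of k] by (simp add: m_def)
      qed
      ultimately show ?thesis using vi by simp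
    qed
    have "(\<lambda>k. (t - s) / real (Suc k)) \<longlonglongrightarrow> 0"
      by (rule LIMSEQ_Suc[OF lim_const_over_n])
    then have "(\<lambda>k. v k - m) \<longlonglongrightarrow> 0"
      by (rule Lim_null_comparison[rotated]) (use close in auto)
    then have vm: "v \<longlonglongrightarrow> m" by (simp add: LIM_zero_iff)
    have "m \<in> {0..T}" using s by (auto simp: m_def)
    then have "(\<lambda>k. Y (v k) \<omega>) \<longlonglongrightarrow> Y m \<omega>"
    proof (rule continuous_on_tendsto_compose[OF cont[OF w] vm], intro always_eventually allI)
      show "v k \<in> {0..T}" for k using v[of k] s by simp
    qed
    then have "(\<lambda>k. Z s t k \<omega>) \<longlonglongrightarrow> Y m \<omega> - Y s \<omega>"
      unfolding N(4) v_def by (intro tendsto_intros)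
    \<comment> \<open>If \<tau> <= s, both sides vanish, since both stopped values are taken at
      \<tau>.\<close>
    moreover have "Y m \<omega> - Y s \<omega> = Y (min t (\<tau> \<omega>)) \<omega> - Y (min s (\<tau> \<omega>)) \<omega>"
      using s by (cases "\<tau> \<omega> \<le> s") (auto simp: m_def min_def max_def)
    ultimately show "(\<lambda>k. Z s t k \<omega>) \<longlonglongrightarrow> Y (min t (\<tau> \<omega>)) \<omega> - Y (min s (\<tau> \<omega>)) \<omega>" by simp
  qed
  have Z_meas: "Z s t k \<in> borel_measurable (F t)" if s: "0 \<le> s" "s \<le> t" "t \<le> T" for s t k
    unfolding Z_def
  proof (intro borel_measurable_sum measurable_If borel_measurable_diff)
    fix i assume "i \<in> {..<Suc k}"
    then have i: "u s t k i \<in> {0..T}" "u s t k (Suc i) \<in> {0..T}" "u s t k i \<le> t" "u s t k (Suc i) \<le> t"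
      using u_ge[OF s(2), of k i] u_ge[OF s(2), of k "Suc i"] u_le[OF s(2), of i k]
        u_le[OF s(2), of "Suc i" k] s by auto
    show "Y (u s t k i) \<in> borel_measurable (F t)" "Y (u s t k (Suc i)) \<in> borel_measurable (F t)"
      by (rule up[OF ad]; use i in simp)+
    show "{\<omega> \<in> space (F t). u s t k i < \<tau> \<omega>} \<in> sets (F t)"
      using before[of "u s t k i"] mono[OF i(3)] by (auto simp: spF)
  qed auto
  \<comment> \<open>Starting the sums at 0, where the stopped process is \<open>Y 0\<close>, makes
    the same approximation yield adaptedness.\<close>
  have stopped_meas: "(\<lambda>\<omega>. Y (min t (\<tau> \<omega>)) \<omega>) \<in> borel_measurable (F t)" if t: "t \<in> {0..T}" for t
  proof (rule borel_measurable_LIMSEQ_real[where u="\<lambda>k \<omega>. Z 0 t k \<omega> + Y 0 \<omega>"])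
    show "(\<lambda>\<omega>. Z 0 t k \<omega> + Y 0 \<omega>) \<in> borel_measurable (F t)" for k
      using t by (intro borel_measurable_add Z_meas up[OF ad[of 0]]) auto
    fix \<omega> assume "\<omega> \<in> space (F t)"
    then have w: "\<omega> \<in> space M" by (simp add: spF)
    have "min 0 (\<tau> \<omega>) = 0" using \<tau>[OF w] by simp
    then show "(\<lambda>k. Z 0 t k \<omega> + Y 0 \<omega>) \<longlonglongrightarrow> Y (min t (\<tau> \<omega>)) \<omega>"
      using tendsto_add[OF Z_lim[OF w, of 0 t] tendsto_const[of "Y 0 \<omega>"]] t by simp
  qed
  show ?thesis
  proof (rule martingale_upto_boundedI[OF sub stopped_meas])
    show sb: "\<bar>Y (min t (\<tau> \<omega>)) \<omega>\<bar> \<le> C" if "t \<in> {0..T}" "\<omega> \<in> space M" for t \<omega>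
      using that \<tau>[OF that(2)] by (intro bd) auto
    fix s t A assume s: "0 \<le> s" "s \<le> t" "t \<le> T" and A: "A \<in> sets (F s)"
    have AM: "A \<in> sets M" using sub[of s] A by (auto simp: subalgebra_def)
    have int: "set_integrable M A h" if "h \<in> borel_measurable M" "\<And>\<omega>. \<omega> \<in> space M \<Longrightarrow> \<bar>h \<omega>\<bar> \<le> B"
      for h :: "'a \<Rightarrow> real" and B
      unfolding set_integrable_def
      by (intro integrable_mult_indicator AM integrable_const_bound[of _ B]) (use that in auto)
    have "(LINT \<omega>:A|M. Z s t k \<omega>) = 0" for k
    proof -
      let ?B = "\<lambda>i. {\<omega>\<in>space M. u s t k i < \<tau> \<omega>}"
      have "(LINT \<omega>:A|M. Z s t k \<omega>)
        = (LINT \<omega>|M. (\<Sum>i<Suc k. indicat_real (A \<inter> ?B i) \<omega> *\<^sub>R Y (u s t k (Suc i)) \<omega>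
              - indicat_real (A \<inter> ?B i) \<omega> *\<^sub>R Y (u s t k i) \<omega>))"
        unfolding set_lebesgue_integral_def Z_def scaleR_sum_right
        by (intro Bochner_Integration.integral_cong sum.cong refl) (auto simp: indicator_def)
      also have "\<dots> = (\<Sum>i<Suc k. (LINT \<omega>:A \<inter> ?B i|M. Y (u s t k (Suc i)) \<omega>) - (LINT \<omega>:A \<inter> ?B i|M. Y (u s t k i) \<omega>))"
        unfolding set_lebesgue_integral_def
      proof (subst Bochner_Integration.integral_sum)
        have si: "integrable M (\<lambda>\<omega>. indicat_real (A \<inter> ?B i) \<omega> *\<^sub>R Y (u s t k j) \<omega>)"
          if "i < Suc k" "j \<le> Suc k" for i j
        proof (intro integrable_mult_indicator)
          show "A \<inter> ?B i \<in> sets M"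
            using AM before[of "u s t k i"] sub[of "u s t k i"] by (auto simp: subalgebra_def)
          show "integrable M (Y (u s t k j))"
            using Y u_ge[OF s(2), of k j] u_le[OF s(2) that(2)] s by (auto simp: martingale_upto_def)
        qed
        show "integrable M (\<lambda>\<omega>. indicat_real (A \<inter> ?B i) \<omega> *\<^sub>R Y (u s t k (Suc i)) \<omega>
              - indicat_real (A \<inter> ?B i) \<omega> *\<^sub>R Y (u s t k i) \<omega>)" if "i \<in> {..<Suc k}" for i
          using that by (intro Bochner_Integration.integrable_diff si) auto
        show "(\<Sum>i<Suc k. LINT \<omega>|M. indicat_real (A \<inter> ?B i) \<omega> *\<^sub>R Y (u s t k (Suc i)) \<omega>
              - indicat_real (A \<inter> ?B i) \<omega> *\<^sub>R Y (u s t k i) \<omega>) =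
          (\<Sum>i<Suc k. (LINT \<omega>|M. indicat_real (A \<inter> ?B i) \<omega> *\<^sub>R Y (u s t k (Suc i)) \<omega>)
            - (LINT \<omega>|M. indicat_real (A \<inter> ?B i) \<omega> *\<^sub>R Y (u s t k i) \<omega>))"
          by (intro sum.cong refl Bochner_Integration.integral_diff si) auto
      qed
      also have "\<dots> = 0"
      proof (rule sum.neutral, intro ballI)
        fix i assume "i \<in> {..<Suc k}"
        \<comment> \<open>Whether \<tau> exceeds the grid point is known at that grid point, so the
          martingale property applies on the intersection with A.\<close>
        then have "(LINT \<omega>:A \<inter> ?B i|M. Y (u s t k (Suc i)) \<omega>) = (LINT \<omega>:A \<inter> ?B i|M. Y (u s t k i) \<omega>)"
        proof (intro martingale_upto_set_integral[OF Y sub])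
          show "A \<inter> ?B i \<in> sets (F (u s t k i))"
            using before[of "u s t k i"] A mono[OF u_ge[OF s(2), of k i]] by auto
          show "0 \<le> u s t k i" using u_ge[OF s(2), of k i] s by simp
          show "u s t k i \<le> u s t k (Suc i)" by (rule incseqD[OF u_inc[OF s(2)]]) simp
          assume "i \<in> {..<Suc k}"
          then show "u s t k (Suc i) \<le> T" using u_le[OF s(2), of "Suc i" k] s by simp
        qed
        then show "(LINT \<omega>:A \<inter> ?B i|M. Y (u s t k (Suc i)) \<omega>) - (LINT \<omega>:A \<inter> ?B i|M. Y (u s t k i) \<omega>) = 0"
          by simp
      qed
      finally show ?thesis .
    qed
    moreover have m: "(\<lambda>\<omega>. Y (min r (\<tau> \<omega>)) \<omega>) \<in> borel_measurable M" if "r \<in> {0..T}" for r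
      by (rule measurable_from_subalg[OF sub stopped_meas[OF that]])
    have "(\<lambda>k. LINT \<omega>:A|M. Z s t k \<omega>) \<longlonglongrightarrow> (LINT \<omega>:A|M. Y (min t (\<tau> \<omega>)) \<omega> - Y (min s (\<tau> \<omega>)) \<omega>)"
    proof (rule set_integral_bounded_limit[OF AM])
      show "Z s t k \<in> borel_measurable M" for k
        by (rule measurable_from_subalg[OF sub Z_meas[OF s]])
      show "(\<lambda>\<omega>. Y (min t (\<tau> \<omega>)) \<omega> - Y (min s (\<tau> \<omega>)) \<omega>) \<in> borel_measurable M"
        using s by (intro borel_measurable_diff m) auto
    qed (use Z_lim Z_bd s in auto)
    ultimately have "(LINT \<omega>:A|M. Y (min t (\<tau> \<omega>)) \<omega> - Y (min s (\<tau> \<omega>)) \<omega>) = 0"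
      by (simp add: LIMSEQ_const_iff)
    moreover have "(LINT \<omega>:A|M. Y (min t (\<tau> \<omega>)) \<omega> - Y (min s (\<tau> \<omega>)) \<omega>)
      = (LINT \<omega>:A|M. Y (min t (\<tau> \<omega>)) \<omega>) - (LINT \<omega>:A|M. Y (min s (\<tau> \<omega>)) \<omega>)"
      using s by (intro set_integral_diff int[OF m sb]) auto
    ultimately show "(LINT \<omega>:A|M. Y (min t (\<tau> \<omega>)) \<omega>) = (LINT \<omega>:A|M. Y (min s (\<tau> \<omega>)) \<omega>)" by simp
  qed
qed

text \<open>Rounding the time down to a grid of mesh \<open>1 / k\<close> gives jointly measurable approximations.\<close>

lemma continuous_process_jointly_measurable:
  fixes X :: "real \<Rightarrow> 'a \<Rightarrow> real"
  assumes meas: "\<And>s. s \<in> {a..b} \<Longrightarrow> X s \<in> borel_measurable N"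
    and cont: "\<And>\<omega>. \<omega> \<in> space N \<Longrightarrow> continuous_on {a..b} (\<lambda>s. X s \<omega>)" and "a \<le> b"
  shows "(\<lambda>(s, \<omega>). X (max a (min b s)) \<omega>) \<in> borel_measurable (borel \<Otimes>\<^sub>M N)"
proof -
  define r where "r k s = real_of_int \<lfloor>real (Suc k) * s\<rfloor> / real (Suc k)" for k s
  have lim: "(\<lambda>k. r k s) \<longlonglongrightarrow> s" for s
  proof -
    have close: "\<bar>r k s - s\<bar> \<le> 1 / real (Suc k)" for k
    proof -
      have "\<bar>real_of_int \<lfloor>real (Suc k) * s\<rfloor> - real (Suc k) * s\<bar> \<le> 1" by linarith
      then have "\<bar>real_of_int \<lfloor>real (Suc k) * s\<rfloor> - real (Suc k) * s\<bar> / real (Suc k) \<le> 1 / real (Suc k)"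
        by (intro divide_right_mono) auto
      moreover have "r k s - s = (real_of_int \<lfloor>real (Suc k) * s\<rfloor> - real (Suc k) * s) / real (Suc k)"
        by (simp add: r_def diff_divide_distrib)
      ultimately show ?thesis by simp
    qed
    have "(\<lambda>k. 1 / real (Suc k)) \<longlonglongrightarrow> 0"
      by (rule LIMSEQ_Suc[OF lim_const_over_n])
    then have "(\<lambda>k. r k s - s) \<longlonglongrightarrow> 0"
      by (rule Lim_null_comparison[rotated]) (use close in auto)
    then show ?thesis by (simp add: LIM_zero_iff)
  qed
  show ?thesis
  proof (rule borel_measurable_LIMSEQ_real[where u="\<lambda>k (s, \<omega>). X (max a (min b (r k s))) \<omega>"])
    show "(\<lambda>(s, \<omega>). X (max a (min b (r k s))) \<omega>) \<in> borel_measurable (borel \<Otimes>\<^sub>M N)" for k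
    proof -
      \<comment> \<open>Rounded times take countably many values, so each may be treated as fixed;
        clamping returns a rounded time that has left {a..b}.\<close>
      have "(\<lambda>z. X (max a (min b (real_of_int j / real (Suc k)))) (snd z)) \<in> borel_measurable (borel \<Otimes>\<^sub>M N)" for j
        by (rule measurable_compose[OF measurable_snd meas]) (use \<open>a \<le> b\<close> in auto)
      moreover have "(\<lambda>z. \<lfloor>real (Suc k) * fst z\<rfloor>) \<in> measurable (borel \<Otimes>\<^sub>M N) (count_space UNIV)"
        by measurable
      ultimately have "(\<lambda>z. X (max a (min b (real_of_int \<lfloor>real (Suc k) * fst z\<rfloor> / real (Suc k)))) (snd z))
          \<in> borel_measurable (borel \<Otimes>\<^sub>M N)"
        by (rule measurable_compose_countable)
      then show ?thesis by (simp add: r_def split_beta')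
    qed
    fix z :: "real \<times> 'a" assume z: "z \<in> space (borel \<Otimes>\<^sub>M N)"
    obtain s \<omega> where [simp]: "z = (s, \<omega>)" by fastforce
    have w: "\<omega> \<in> space N" using z by (simp add: space_pair_measure)
    have "(\<lambda>k. X (max a (min b (r k s))) \<omega>) \<longlonglongrightarrow> X (max a (min b s)) \<omega>"
      by (rule continuous_on_tendsto_compose[OF cont[OF w]])
         (use \<open>a \<le> b\<close> in \<open>auto intro!: tendsto_intros lim\<close>)
    then show "(\<lambda>k. case z of (s, \<omega>) \<Rightarrow> X (max a (min b (r k s))) \<omega>)
        \<longlonglongrightarrow> (case z of (s, \<omega>) \<Rightarrow> X (max a (min b s)) \<omega>)" by simp
  qed
qed

section \<open>Continuous processes and their compensated functionals\<close>

text \<open>The measure space N is arbitrary on purpose: taking it to be F t with b = t gives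
  adaptedness of the time integral, as only values of X up to b enter.\<close>

lemma set_integral_process_measurable:
  fixes X :: "real \<Rightarrow> 'a \<Rightarrow> real"
  assumes meas: "\<And>s. s \<in> {a..b} \<Longrightarrow> X s \<in> borel_measurable N"
    and cont: "\<And>\<omega>. \<omega> \<in> space N \<Longrightarrow> continuous_on {a..b} (\<lambda>s. X s \<omega>)" and "a \<le> b"
  shows "(\<lambda>\<omega>. LINT s:{a..b}|lborel. X s \<omega>) \<in> borel_measurable N"
proof -
  have "(\<lambda>(\<omega>, s). X (max a (min b s)) \<omega>) \<in> borel_measurable (N \<Otimes>\<^sub>M borel)"
    using measurable_compose[OF measurable_pair_swap' continuous_process_jointly_measurable[OF assms]]
    by (simp add: split_beta')
  then have [measurable]: "(\<lambda>(\<omega>, s). X (max a (min b s)) \<omega>) \<in> borel_measurable (N \<Otimes>\<^sub>M lborel)"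
    by simp
  have "(\<lambda>\<omega>. LINT s|lborel. indicat_real {a..b} s *\<^sub>R X (max a (min b s)) \<omega>) \<in> borel_measurable N"
    by measurable
  also have "(\<lambda>\<omega>. LINT s|lborel. indicat_real {a..b} s *\<^sub>R X (max a (min b s)) \<omega>)
      = (\<lambda>\<omega>. LINT s:{a..b}|lborel. X s \<omega>)"
    unfolding set_lebesgue_integral_def
    by (intro ext Bochner_Integration.integral_cong refl) (auto simp: indicator_def)
  finally show ?thesis .
qed

text \<open>Nothing is known about \<open>p t\<close> for t outside (0, T]. Redirecting such times
  to T gives a function measurable everywhere, and the indicator hides the change.\<close>

lemma restricted_density_measurable:
  fixes p :: "real \<Rightarrow> real \<Rightarrow> ennreal" and T :: real
  assumes p: "case_prod p \<in> borel_measurable (restrict_space borel {0<..T} \<Otimes>\<^sub>M borel)" and "0 < T"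
  shows "(\<lambda>(t, x). p t x * indicator {0<..T} t) \<in> borel_measurable (lborel \<Otimes>\<^sub>M lborel)"
proof -
  define c where "c t = (if t \<in> {0<..T} then t else T)" for t
  have "c \<in> borel_measurable borel" unfolding c_def[abs_def] by measurable
  then have "c \<in> measurable borel (restrict_space borel {0<..T})"
    using \<open>0 < T\<close> by (intro measurable_restrict_space2) (auto simp: c_def)
  then have "(\<lambda>(t, x). p (c t) x) \<in> borel_measurable (borel \<Otimes>\<^sub>M borel)"
    using measurable_compose[OF _ p, of "\<lambda>(t, x). (c t, x)" "borel \<Otimes>\<^sub>M borel"]
    by (simp add: split_beta')
  then have [measurable]: "(\<lambda>(t, x). p (c t) x) \<in> borel_measurable (lborel \<Otimes>\<^sub>M lborel)"
    by (simp add: measurable_lborel1 cong: measurable_cong_sets)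
  have "(\<lambda>(t, x). p (c t) x * indicator {0<..T} t) \<in> borel_measurable (lborel \<Otimes>\<^sub>M lborel)"
    by measurable
  also have "(\<lambda>(t, x). p (c t) x * indicator {0<..T} t) = (\<lambda>(t, x). p t x * indicator {0<..T} t)"
    by (auto simp: fun_eq_iff c_def indicator_def)
  finally show ?thesis .
qed

locale continuous_process = prob_space M for M :: "'a measure" +
  fixes T x0 :: real and X :: "real \<Rightarrow> 'a \<Rightarrow> real"
  assumes T_pos: "0 < T"
    and X_meas: "\<And>t. t \<in> {0..T} \<Longrightarrow> X t \<in> borel_measurable M"
    and X_cont: "\<And>\<omega>. \<omega> \<in> space M \<Longrightarrow> continuous_on {0..T} (\<lambda>t. X t \<omega>)"
    and X_0: "\<And>\<omega>. \<omega> \<in> space M \<Longrightarrow> X 0 \<omega> = x0"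
begin

text \<open>Two spaces are used side by side: densities refer to M, whereas the filtration contains
  null sets of the completion and so conditional expectations are taken there.\<close>

sublocale N: prob_space "completion M"
  by (rule prob_space_completion)

abbreviation "F \<equiv> canonical_filtration M T X"

lemma subalgebra_F: "subalgebra (completion M) (F t)"
  by (rule subalgebra_canonical_filtration) (use X_meas in blast)

lemma space_F: "space (F t) = space M"
  using subalgebra_F[of t] by (simp add: subalgebra_def)

lemma sets_F_mono: "s \<le> t \<Longrightarrow> sets (F s) \<subseteq> sets (F t)"
  unfolding sets_canonical_filtration by (intro INF_superset_mono) auto

lemma X_measurable_F:
  assumes "0 \<le> s" "s \<le> T" "s \<le> t"
  shows "X s \<in> borel_measurable (F t)"
proof (rule measurableI)
  fix A :: "real set" assume A: "A \<in> sets borel"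
  have "X s -` A \<inter> space M \<in> sets (augmented_history M T X u)" if "t < u" for u
    unfolding augmented_history_def sets_measure_of[OF augmented_history_gen_subset]
    by (rule sigma_sets.Basic) (use A assms that in auto)
  then show "X s -` A \<inter> space (F t) \<in> sets (F t)"
    by (simp add: space_F sets_canonical_filtration)
qed simp

text \<open>The integrand H is a free argument, so that estimates compare pairs (f, H) without
  unfolding the operator.\<close>

definition compensated :: "(real \<Rightarrow> real) \<Rightarrow> (real \<Rightarrow> real) \<Rightarrow> real \<Rightarrow> 'a \<Rightarrow> real" where
  "compensated f H t \<omega> = f (X t \<omega>) - f x0 - (LINT s:{0..t}|lborel. H (X s \<omega>))"

lemma continuous_on_comp_X:
  assumes "continuous_on UNIV h" "\<omega> \<in> space M" "t \<le> T"
  shows "continuous_on {0..t} (\<lambda>s. h (X s \<omega>))"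
  by (rule continuous_on_compose2[OF assms(1) continuous_on_subset[OF X_cont[OF assms(2)]]])
     (use assms(3) in auto)

lemma comp_X_integrable:
  fixes h :: "real \<Rightarrow> real"
  assumes "continuous_on UNIV h" "\<omega> \<in> space M" "t \<le> T"
  shows "set_integrable lborel {0..t} (\<lambda>s. h (X s \<omega>))"
  by (rule borel_integrable_atLeastAtMost'[OF continuous_on_comp_X[OF assms]])

lemma compensated_adapted:
  assumes f: "continuous_on UNIV f" and H: "continuous_on UNIV H" and t: "t \<in> {0..T}"
  shows "compensated f H t \<in> borel_measurable (F t)"
proof -
  have "(\<lambda>\<omega>. LINT s:{0..t}|lborel. H (X s \<omega>)) \<in> borel_measurable (F t)"
  proof (rule set_integral_process_measurable)
    show "(\<lambda>\<omega>. H (X s \<omega>)) \<in> borel_measurable (F t)" if "s \<in> {0..t}" for s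
      using that t by (intro measurable_compose[OF X_measurable_F] borel_measurable_continuous_onI H) auto
  qed (use t continuous_on_comp_X[OF H] in \<open>auto simp: space_F\<close>)
  moreover have "(\<lambda>\<omega>. f (X t \<omega>)) \<in> borel_measurable (F t)"
    using t by (intro measurable_compose[OF X_measurable_F] borel_measurable_continuous_onI f) auto
  ultimately show ?thesis
    unfolding compensated_def[abs_def] by (intro borel_measurable_diff) auto
qed

lemma compensated_continuous:
  assumes f: "continuous_on UNIV f" and H: "continuous_on UNIV H" and w: "\<omega> \<in> space M"
  shows "continuous_on {0..T} (\<lambda>t. compensated f H t \<omega>)"
proof -
  have "continuous_on {0..T} (\<lambda>t. integral {0..t} (\<lambda>s. H (X s \<omega>)))"
    by (intro indefinite_integral_continuous_1 integrable_continuous_real continuous_on_comp_X H w) simp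
  moreover have "integral {0..t} (\<lambda>s. H (X s \<omega>)) = (LINT s:{0..t}|lborel. H (X s \<omega>))" if "t \<in> {0..T}" for t
    using that by (intro set_borel_integral_eq_integral(2)[symmetric] comp_X_integrable H w) auto
  ultimately have "continuous_on {0..T} (\<lambda>t. LINT s:{0..t}|lborel. H (X s \<omega>))"
    by (metis (no_types, lifting) continuous_on_cong)
  then show ?thesis
    unfolding compensated_def by (intro continuous_intros continuous_on_comp_X f w) auto
qed

text \<open>The error e is counted twice, at \<open>X t\<close> and at \<open>x0\<close>. The bound
  lives in \<open>ennreal\<close> because the time integral of W along a path may be
  infinite.\<close>

lemma compensated_diff_bound:
  assumes c: "continuous_on UNIV H1" "continuous_on UNIV H2" and [measurable]: "W \<in> borel_measurable borel"
    and f: "\<And>x. \<bar>f1 x - f2 x\<bar> \<le> e" and H: "\<And>x. \<bar>H1 x - H2 x\<bar> \<le> W x"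
    and t: "t \<in> {0..T}" and w: "\<omega> \<in> space M"
  shows "ennreal \<bar>compensated f1 H1 t \<omega> - compensated f2 H2 t \<omega>\<bar>
     \<le> ennreal (2 * e) + (\<integral>\<^sup>+s\<in>{0..T}. ennreal (W (X s \<omega>)) \<partial>lborel)"
proof -
  have e0: "0 \<le> e" using f[of 0] by linarith
  have c': "continuous_on UNIV (\<lambda>x. H1 x - H2 x)" by (intro continuous_intros c)
  define D where "D = (LINT s:{0..t}|lborel. H1 (X s \<omega>) - H2 (X s \<omega>))"
  have D: "D = (LINT s:{0..t}|lborel. H1 (X s \<omega>)) - (LINT s:{0..t}|lborel. H2 (X s \<omega>))"
    unfolding D_def using t by (intro set_integral_diff comp_X_integrable c w) auto
  have "\<bar>compensated f1 H1 t \<omega> - compensated f2 H2 t \<omega>\<bar> \<le> 2 * e + \<bar>D\<bar>"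
    using f[of "X t \<omega>"] f[of x0] unfolding compensated_def D by linarith
  then have "ennreal \<bar>compensated f1 H1 t \<omega> - compensated f2 H2 t \<omega>\<bar> \<le> ennreal (2 * e) + ennreal \<bar>D\<bar>"
    using e0 by (simp flip: ennreal_plus add: ennreal_leI)
  also have "ennreal \<bar>D\<bar> \<le> (\<integral>\<^sup>+s. norm (indicat_real {0..t} s *\<^sub>R (H1 (X s \<omega>) - H2 (X s \<omega>))) \<partial>lborel)"
    using integral_norm_bound_ennreal[OF comp_X_integrable[OF c' w, of t, unfolded set_integrable_def]] t
    by (simp add: D_def set_lebesgue_integral_def)
  also have "\<dots> \<le> (\<integral>\<^sup>+s\<in>{0..T}. ennreal (W (X s \<omega>)) \<partial>lborel)"
    using t H by (intro nn_integral_mono) (auto simp: indicator_def ennreal_leI)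
  finally show ?thesis by (simp add: add_left_mono)
qed

lemma compensated_bound:
  assumes f: "\<And>x. \<bar>f x\<bar> \<le> C" and H: "\<And>x. \<bar>H x\<bar> \<le> C" "continuous_on UNIV H"
    and t: "t \<in> {0..T}" and w: "\<omega> \<in> space M"
  shows "\<bar>compensated f H t \<omega>\<bar> \<le> 2 * C + C * T"
proof -
  have C: "0 \<le> C" using f[of 0] by linarith
  have "norm (LINT s:{0..t}|lborel. H (X s \<omega>)) \<le> (LINT s:{0..t}|lborel. norm (H (X s \<omega>)))"
    using t by (intro set_integral_norm_bound comp_X_integrable H w) auto
  also have "\<dots> \<le> (LINT s:{0..t}|lborel. C)"
  proof (rule set_integral_mono)
    show "set_integrable lborel {0..t} (\<lambda>s. norm (H (X s \<omega>)))"
      using t by (intro set_integrable_norm comp_X_integrable H w) auto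
    show "set_integrable lborel {0..t} (\<lambda>s. C)"
      by (rule borel_integrable_atLeastAtMost') simp
  qed (use H in simp)
  also have "\<dots> = C * t"
    using t by (simp add: set_lebesgue_integral_def)
  also have "\<dots> \<le> C * T" using C t by (intro mult_left_mono) auto
  finally have "\<bar>LINT s:{0..t}|lborel. H (X s \<omega>)\<bar> \<le> C * T" by simp
  then show ?thesis
    using f[of "X t \<omega>"] f[of x0] unfolding compensated_def by linarith
qed

text \<open>The L^1 estimate behind the limit, from the pathwise bound by integration. The constant
  C only ensures integrability and does not appear in the result.\<close>

lemma compensated_set_integral_diff:
  assumes cf: "continuous_on UNIV f1" "continuous_on UNIV f2"
    and cH: "continuous_on UNIV H1" "continuous_on UNIV H2"
    and bd: "\<And>x. \<bar>f1 x\<bar> \<le> C" "\<And>x. \<bar>f2 x\<bar> \<le> C" "\<And>x. \<bar>H1 x\<bar> \<le> C" "\<And>x. \<bar>H2 x\<bar> \<le> C"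
    and W [measurable]: "W \<in> borel_measurable borel"
    and f: "\<And>x. \<bar>f1 x - f2 x\<bar> \<le> e" and H: "\<And>x. \<bar>H1 x - H2 x\<bar> \<le> W x"
    and E: "(\<integral>\<^sup>+\<omega>. (\<integral>\<^sup>+s\<in>{0..T}. ennreal (W (X s \<omega>)) \<partial>lborel) \<partial>M) \<le> ennreal E" "0 \<le> E"
    and meas: "(\<lambda>\<omega>. \<integral>\<^sup>+s\<in>{0..T}. ennreal (W (X s \<omega>)) \<partial>lborel) \<in> borel_measurable M"
    and t: "t \<in> {0..T}" and A: "A \<in> sets (completion M)"
  shows "\<bar>(LINT \<omega>:A|completion M. compensated f1 H1 t \<omega>) - (LINT \<omega>:A|completion M. compensated f2 H2 t \<omega>)\<bar>
    \<le> 2 * e + E"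
proof -
  have e0: "0 \<le> e" using f[of 0] by linarith
  have int: "set_integrable (completion M) A (compensated f H t)"
    if "continuous_on UNIV f" "continuous_on UNIV H" "\<And>x. \<bar>f x\<bar> \<le> C" "\<And>x. \<bar>H x\<bar> \<le> C" for f H
    unfolding set_integrable_def
  proof (intro integrable_mult_indicator A N.integrable_const_bound[of _ "2 * C + C * T"])
    show "compensated f H t \<in> borel_measurable (completion M)"
      by (rule measurable_from_subalg[OF subalgebra_F compensated_adapted[OF that(1,2) t]])
    show "AE \<omega> in completion M. norm (compensated f H t \<omega>) \<le> 2 * C + C * T"
      using compensated_bound[OF that(3,4,2) t] by (intro AE_I2) simp
  qed
  let ?D = "\<lambda>\<omega>. compensated f1 H1 t \<omega> - compensated f2 H2 t \<omega>"
  have "set_integrable (completion M) A ?D"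
    by (intro set_integral_diff int cf cH bd)
  then have "norm (LINT \<omega>:A|completion M. ?D \<omega>) \<le> (\<integral>\<^sup>+\<omega>. norm (indicat_real A \<omega> *\<^sub>R ?D \<omega>) \<partial>completion M)"
    unfolding set_integrable_def set_lebesgue_integral_def by (rule integral_norm_bound_ennreal)
  also have "\<dots> \<le> (\<integral>\<^sup>+\<omega>. ennreal (2 * e) + (\<integral>\<^sup>+s\<in>{0..T}. ennreal (W (X s \<omega>)) \<partial>lborel) \<partial>completion M)"
  proof (rule nn_integral_mono)
    fix \<omega> assume "\<omega> \<in> space (completion M)"
    then have "ennreal \<bar>?D \<omega>\<bar> \<le> ennreal (2 * e) + (\<integral>\<^sup>+s\<in>{0..T}. ennreal (W (X s \<omega>)) \<partial>lborel)"
      by (intro compensated_diff_bound cH W f H t) simp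
    then show "ennreal (norm (indicat_real A \<omega> *\<^sub>R ?D \<omega>))
        \<le> ennreal (2 * e) + (\<integral>\<^sup>+s\<in>{0..T}. ennreal (W (X s \<omega>)) \<partial>lborel)"
      by (auto simp: indicator_def)
  qed
  also have "\<dots> = ennreal (2 * e) + (\<integral>\<^sup>+\<omega>. (\<integral>\<^sup>+s\<in>{0..T}. ennreal (W (X s \<omega>)) \<partial>lborel) \<partial>M)"
    \<comment> \<open>Nonnegative integrals over M and over its completion agree, which brings in
      the bound E stated for M.\<close>
    unfolding nn_integral_completion
    by (subst nn_integral_add) (use meas in \<open>auto simp: emeasure_space_1\<close>)
  also have "\<dots> \<le> ennreal (2 * e) + ennreal E"
    by (intro add_left_mono E)
  finally have "norm (LINT \<omega>:A|completion M. ?D \<omega>) \<le> 2 * e + E"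
    using e0 E(2) by (simp flip: ennreal_plus)
  then show ?thesis
    by (subst (asm) set_integral_diff(2)) (auto intro!: int cf cH bd)
qed

section \<open>Occupation times and the densities\<close>

lemma X_jointly_measurable:
  "(\<lambda>(\<omega>, s). X (max 0 (min T s)) \<omega>) \<in> borel_measurable (M \<Otimes>\<^sub>M lborel)"
proof -
  have "(\<lambda>(s, \<omega>). X (max 0 (min T s)) \<omega>) \<in> borel_measurable (borel \<Otimes>\<^sub>M M)"
    by (rule continuous_process_jointly_measurable) (use X_meas X_cont T_pos in auto)
  from measurable_compose[OF measurable_pair_swap' this] show ?thesis
    by (simp add: split_beta')
qed

text \<open>Joint measurability is available only for the process with clamped time, since X is
  uncontrolled outside {0..T}; the indicator makes the integrands equal.\<close>

lemma nn_integral_comp_X_eq: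
  "(\<integral>\<^sup>+s\<in>{0..T}. W (X s \<omega>) \<partial>lborel) = (\<integral>\<^sup>+s\<in>{0..T}. W (X (max 0 (min T s)) \<omega>) \<partial>lborel)"
  by (intro nn_integral_cong) (auto simp: indicator_def)

lemma nn_integral_comp_X_measurable:
  assumes [measurable]: "W \<in> borel_measurable borel"
  shows "(\<lambda>\<omega>. \<integral>\<^sup>+s\<in>{0..T}. W (X s \<omega>) \<partial>lborel) \<in> borel_measurable M"
proof -
  note X_jointly_measurable [measurable]
  show ?thesis unfolding nn_integral_comp_X_eq by measurable
qed

text \<open>Tonelli's theorem brings the time integral outside, the density replaces the law of X at
  almost every time, and a second exchange puts the space variable outside, in the form of
  hypothesis (ii).\<close>

lemma occupation_formula:
  fixes p :: "real \<Rightarrow> real \<Rightarrow> ennreal"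
  assumes W [measurable]: "W \<in> borel_measurable borel"
    and p: "case_prod p \<in> borel_measurable (restrict_space borel {0<..T} \<Otimes>\<^sub>M borel)"
    and dist: "AE t in lborel. t \<in> {0<..T} \<longrightarrow> distributed M lborel (X t) (p t)"
  shows "(\<integral>\<^sup>+\<omega>. (\<integral>\<^sup>+s\<in>{0..T}. W (X s \<omega>) \<partial>lborel) \<partial>M)
    = (\<integral>\<^sup>+x. (\<integral>\<^sup>+s\<in>{0<..T}. W x * p s x \<partial>lborel) \<partial>lborel)"
proof -
  note X_jointly_measurable [measurable]
  interpret P: pair_sigma_finite M lborel ..
  note restricted_density_measurable[OF p T_pos, measurable]
  have "(\<integral>\<^sup>+\<omega>. (\<integral>\<^sup>+s\<in>{0..T}. W (X s \<omega>) \<partial>lborel) \<partial>M)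
      = (\<integral>\<^sup>+s. (\<integral>\<^sup>+\<omega>. W (X (max 0 (min T s)) \<omega>) * indicator {0..T} s \<partial>M) \<partial>lborel)"
    unfolding nn_integral_comp_X_eq by (rule P.Fubini'[symmetric]) measurable
  also have "\<dots> = (\<integral>\<^sup>+s. (\<integral>\<^sup>+x. W x * (p s x * indicator {0<..T} s) \<partial>lborel) \<partial>lborel)"
  proof (rule nn_integral_cong_AE)
    \<comment> \<open>At time 0 the process is deterministic and has no density; this single time is
      the difference between {0..T} and {0<..T}.\<close>
    have "AE s in lborel. s \<noteq> (0::real)" by (rule AE_lborel_singleton)
    with dist show "AE s in lborel. (\<integral>\<^sup>+\<omega>. W (X (max 0 (min T s)) \<omega>) * indicator {0..T} s \<partial>M)
        = (\<integral>\<^sup>+x. W x * (p s x * indicator {0<..T} s) \<partial>lborel)"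
    proof eventually_elim
      case (elim s)
      show ?case
      proof (cases "s \<in> {0<..T}")
        case True
        then have d: "distributed M lborel (X s) (p s)" using elim by simp
        have "max 0 (min T s) = s" using True by auto
        moreover have "(\<integral>\<^sup>+x. p s x * W x \<partial>lborel) = (\<integral>\<^sup>+\<omega>. W (X s \<omega>) \<partial>M)"
          by (rule distributed_nn_integral[OF d]) simp
        ultimately show ?thesis using True by (simp add: mult.commute)
      next
        case False
        then have "s \<notin> {0..T}" using elim by auto
        then show ?thesis using False by simp
      qed
    qed
  qed
  also have "\<dots> = (\<integral>\<^sup>+x. (\<integral>\<^sup>+s. W x * (p s x * indicator {0<..T} s) \<partial>lborel) \<partial>lborel)"
    by (rule lborel_pair.Fubini'[symmetric]) measurable
  also have "\<dots> = (\<integral>\<^sup>+x. (\<integral>\<^sup>+s\<in>{0<..T}. W x * p s x \<partial>lborel) \<partial>lborel)"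
    by (simp add: mult.assoc)
  finally show ?thesis .
qed

section \<open>Exit times from symmetric intervals\<close>

definition exit_time :: "real \<Rightarrow> 'a \<Rightarrow> real" where
  "exit_time R \<omega> = Inf (insert T {t\<in>{0..T}. R \<le> \<bar>X t \<omega>\<bar>})"

text \<open>Including T in the infimum keeps the set non-empty and caps the exit time at T, as a
  localizing sequence on {0..T} requires.\<close>

lemma exit_time_le:
  "exit_time R \<omega> \<le> T" "t \<in> {0..T} \<Longrightarrow> R \<le> \<bar>X t \<omega>\<bar> \<Longrightarrow> exit_time R \<omega> \<le> t"
  unfolding exit_time_def using T_pos by (auto intro!: cInf_lower bdd_belowI[of _ 0])

lemma exit_time_attained:
  assumes w: "\<omega> \<in> space M"
  shows "exit_time R \<omega> = T \<or> exit_time R \<omega> \<in> {0..T} \<and> R \<le> \<bar>X (exit_time R \<omega>) \<omega>\<bar>"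
proof -
  have "closed {t\<in>{0..T}. R \<le> \<bar>X t \<omega>\<bar>}"
    by (intro continuous_on_closed_Collect_le continuous_intros X_cont[OF w])
  then have "closed (insert T {t\<in>{0..T}. R \<le> \<bar>X t \<omega>\<bar>})" by (rule closed_insert)
  then have "exit_time R \<omega> \<in> insert T {t\<in>{0..T}. R \<le> \<bar>X t \<omega>\<bar>}"
    unfolding exit_time_def using T_pos by (intro closed_contains_Inf bdd_belowI[of _ 0]) auto
  then show ?thesis by auto
qed

lemma exit_time_range: "\<omega> \<in> space M \<Longrightarrow> exit_time R \<omega> \<in> {0..T}"
  using exit_time_attained[of \<omega> R] T_pos by auto

lemma exit_time_mono: "R \<le> R' \<Longrightarrow> exit_time R \<omega> \<le> exit_time R' \<omega>"
  unfolding exit_time_def using T_pos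
  by (intro cInf_superset_mono bdd_belowI[of _ 0]) auto

text \<open>Strictly before the exit time |X| stays below R, and continuity extends the bound to the
  exit time itself. An exit at time 0 leaves no earlier times, so there the bound on x0 is
  used.\<close>

lemma bounded_before_exit:
  assumes w: "\<omega> \<in> space M" and R: "\<bar>x0\<bar> \<le> R" and s: "0 \<le> s" "s \<le> exit_time R \<omega>"
  shows "\<bar>X s \<omega>\<bar> \<le> R"
proof (cases "exit_time R \<omega> = 0")
  case True
  then show ?thesis using s R X_0[OF w] by simp
next
  case False
  define e where "e = exit_time R \<omega>"
  have e: "0 < e" "e \<le> T" using False exit_time_range[OF w, of R] by (auto simp: e_def)
  have cl: "closure {0..<e} = {0..e}" using e(1) by (rule closure_atLeastLessThan)
  show ?thesis
  proof (rule continuous_le_on_closure[where S="{0..<e}" and f="\<lambda>s. \<bar>X s \<omega>\<bar>"])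
    show "continuous_on (closure {0..<e}) (\<lambda>s. \<bar>X s \<omega>\<bar>)"
      unfolding cl using e by (intro continuous_intros continuous_on_subset[OF X_cont[OF w]]) auto
    show "s \<in> closure {0..<e}" unfolding cl using s by (simp add: e_def)
    show "\<bar>X r \<omega>\<bar> \<le> R" if "r \<in> {0..<e}" for r
      using exit_time_le(2)[of r R \<omega>] that e by (fastforce simp: e_def)
  qed
qed

text \<open>A continuous path is bounded on {0..T}, and levels above its bound are never
  reached.\<close>

lemma exit_time_eventually_T:
  assumes w: "\<omega> \<in> space M"
  shows "\<exists>n::nat. exit_time (a + real n) \<omega> = T"
proof -
  have "compact ((\<lambda>t. X t \<omega>) ` {0..T})"
    by (intro compact_continuous_image X_cont w) auto
  then obtain B where B: "\<forall>y\<in>(\<lambda>t. X t \<omega>) ` {0..T}. norm y \<le> B"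
    using compact_imp_bounded bounded_iff by metis
  obtain n where "B - a < real n" using reals_Archimedean2 by blast
  then have "\<not> a + real n \<le> \<bar>X t \<omega>\<bar>" if "t \<in> {0..T}" for t
    using B that by force
  then show ?thesis using exit_time_attained[OF w] by blast
qed

text \<open>For 0 <= t < T the event says that |X| reaches R during {0..t}, an uncountable union. By
  continuity it says that the supremum of |X| over a countable dense set of times is at least
  R.\<close>

lemma stopping_time_exit: "stopping_time F (exit_time R)"
proof
  fix t
  consider "t < 0" | "T \<le> t" | "0 \<le> t" "t < T" by linarith
  then show "Measurable.pred (F t) (\<lambda>\<omega>. exit_time R \<omega> \<le> t)"
  proof cases
    case 1
    then have none: "{\<omega>\<in>space M. exit_time R \<omega> \<le> t} = {}" using exit_time_range[of _ R] by force
    show ?thesis unfolding pred_def space_F none by simp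
  next
    case 2
    then have all: "{\<omega>\<in>space M. exit_time R \<omega> \<le> t} = space M"
      using order.trans[OF exit_time_le(1)[of R]] by auto
    show ?thesis using sets.top[of "F t"] unfolding pred_def space_F all .
  next
    case 3
    obtain D where D: "countable D" "D \<subseteq> {0..t}" "{0..t} \<subseteq> closure D"
      by (rule separable[of "{0..t}"])
    then have cl: "closure D = {0..t}" using closure_minimal[of D "{0..t}"] by auto
    have "exit_time R \<omega> \<le> t \<longleftrightarrow> (\<forall>k. \<exists>q\<in>D. R - 1 / real (Suc k) < \<bar>X q \<omega>\<bar>)" if w: "\<omega> \<in> space M" for \<omega>
    proof -
      have c: "continuous_on {0..t} (\<lambda>s. \<bar>X s \<omega>\<bar>)"
        using 3 by (intro continuous_intros continuous_on_subset[OF X_cont[OF w]]) auto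
      have "exit_time R \<omega> \<le> t \<longleftrightarrow> (\<exists>s\<in>{0..t}. R \<le> \<bar>X s \<omega>\<bar>)"
        using exit_time_attained[OF w, of R] exit_time_le(2)[of _ R \<omega>] 3 by fastforce
      also have "\<dots> \<longleftrightarrow> (\<forall>k. \<exists>q\<in>D. R - 1 / real (Suc k) < \<bar>X q \<omega>\<bar>)"
      proof (intro iffI allI)
        fix k assume "\<exists>s\<in>{0..t}. R \<le> \<bar>X s \<omega>\<bar>"
        then obtain s where s: "s \<in> {0..t}" "R \<le> \<bar>X s \<omega>\<bar>" by blast
        show "\<exists>q\<in>D. R - 1 / real (Suc k) < \<bar>X q \<omega>\<bar>"
        proof (rule ccontr)
          assume "\<not> ?thesis"
          then have "\<And>q. q \<in> D \<Longrightarrow> \<bar>X q \<omega>\<bar> \<le> R - 1 / real (Suc k)" by force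
          then have "\<bar>X s \<omega>\<bar> \<le> R - 1 / real (Suc k)"
            using continuous_le_on_closure[of D "\<lambda>s. \<bar>X s \<omega>\<bar>" s] c s(1) by (simp add: cl)
          moreover have "0 < 1 / real (Suc k)" by simp
          ultimately show False using s(2) by linarith
        qed
      next
        assume k: "\<forall>k. \<exists>q\<in>D. R - 1 / real (Suc k) < \<bar>X q \<omega>\<bar>"
        \<comment> \<open>Compactness turns the approximate levels R - 1/(k + 1) into a time at
          which R is attained.\<close>
        obtain s where s: "s \<in> {0..t}" "\<And>r. r \<in> {0..t} \<Longrightarrow> \<bar>X r \<omega>\<bar> \<le> \<bar>X s \<omega>\<bar>"
          using continuous_attains_sup[OF _ _ c] 3 by auto
        have "R \<le> \<bar>X s \<omega>\<bar>"
        proof (rule LIMSEQ_le_const2)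
          show "(\<lambda>k. R - 1 / real (Suc k)) \<longlonglongrightarrow> R"
            using tendsto_diff[OF tendsto_const LIMSEQ_Suc[OF lim_const_over_n[of 1]], of R] by simp
          show "\<exists>N. \<forall>n\<ge>N. R - 1 / real (Suc n) \<le> \<bar>X s \<omega>\<bar>"
            using k s(2) D(2) by (meson less_le_trans less_imp_le subsetD)
        qed
        then show "\<exists>s\<in>{0..t}. R \<le> \<bar>X s \<omega>\<bar>" using s(1) by blast
      qed
      finally show ?thesis .
    qed
    then have "{\<omega>\<in>space (F t). exit_time R \<omega> \<le> t}
        = {\<omega>\<in>space (F t). \<forall>k. \<exists>q\<in>D. R - 1 / real (Suc k) < \<bar>X q \<omega>\<bar>}"
      by (auto simp: space_F)
    also have "\<dots> \<in> sets (F t)"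
    proof (intro sets.sets_Collect_countable_All sets.sets_Collect_countable_Ex' D(1))
      fix q k assume "q \<in> D"
      then have [measurable]: "X q \<in> borel_measurable (F t)"
        using D(2) 3 by (intro X_measurable_F) auto
      show "{\<omega>\<in>space (F t). R - 1 / real (Suc k) < \<bar>X q \<omega>\<bar>} \<in> sets (F t)"
        by measurable
    qed
    finally show ?thesis by (simp add: pred_def)
  qed
qed

section \<open>The limit argument\<close>

lemma small_occupation_near_zero:
  fixes p :: "real \<Rightarrow> real \<Rightarrow> ennreal"
  assumes p: "case_prod p \<in> borel_measurable (restrict_space borel {0<..T} \<Otimes>\<^sub>M borel)"
    and dist: "AE t in lborel. t \<in> {0<..T} \<longrightarrow> distributed M lborel (X t) (p t)"
    and lim: "((\<lambda>x. \<integral>\<^sup>+t\<in>{0<..T}. ennreal (\<bar>x\<bar> powr a) * p t x \<partial>lborel) \<longlongrightarrow> 0) (at 0)"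
    and "0 < \<epsilon>"
  obtains m where "1 \<le> m" "1 / m \<le> \<epsilon>"
    "\<And>c. 0 \<le> c \<Longrightarrow> (\<integral>\<^sup>+\<omega>. (\<integral>\<^sup>+s\<in>{0..T}.
        ennreal (c * (8 * m * \<bar>X s \<omega>\<bar> powr a * indicator {-1/m..1/m} (X s \<omega>))) \<partial>lborel) \<partial>M)
        \<le> ennreal (16 * c * \<epsilon>)"
proof -
  note pm [measurable] = restricted_density_measurable[OF p T_pos]
  define q where "q x = (\<integral>\<^sup>+t\<in>{0<..T}. ennreal (\<bar>x\<bar> powr a) * p t x \<partial>lborel)" for x
  have "\<forall>\<^sub>F x in at 0. q x < ennreal \<epsilon>"
    using lim \<open>0 < \<epsilon>\<close> unfolding q_def by (intro order_tendstoD(2)) auto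
  then obtain d where d: "d > 0" "\<And>x. x \<noteq> 0 \<Longrightarrow> \<bar>x\<bar> < d \<Longrightarrow> q x < ennreal \<epsilon>"
    by (auto simp: eventually_at dist_real_def)
  \<comment> \<open>The entry 1/\<epsilon> gives 1/m <= \<epsilon>; 2/d instead of 1/d makes 1/m
    strictly smaller than d.\<close>
  define m where "m = max 1 (max (1 / \<epsilon>) (2 / d))"
  have m: "1 \<le> m" "1 / \<epsilon> \<le> m" "2 / d \<le> m" by (auto simp: m_def)
  have m\<epsilon>: "1 / m \<le> \<epsilon>" and md: "1 / m < d"
    using m \<open>0 < \<epsilon>\<close> d(1) by (auto simp: field_simps)
  have q_le: "q x \<le> ennreal \<epsilon>" if "\<bar>x\<bar> \<le> 1 / m" for x
  proof (cases "x = 0")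
    \<comment> \<open>The limit in (ii) ignores x = 0, where the integrand vanishes because
      \<open>0 powr a = 0\<close>.\<close>
    case True
    then show ?thesis by (simp add: q_def)
  next
    case False
    then show ?thesis using d(2)[of x] that md by simp
  qed
  show thesis
  proof (rule that[OF m(1) m\<epsilon>])
    fix c :: real assume c: "0 \<le> c"
    let ?W = "\<lambda>x. c * (8 * m * \<bar>x\<bar> powr a * indicator {-1/m..1/m} x)"
    have "(\<integral>\<^sup>+\<omega>. (\<integral>\<^sup>+s\<in>{0..T}. ennreal (?W (X s \<omega>)) \<partial>lborel) \<partial>M)
        = (\<integral>\<^sup>+x. (\<integral>\<^sup>+s\<in>{0<..T}. ennreal (?W x) * p s x \<partial>lborel) \<partial>lborel)"
      by (rule occupation_formula[OF _ p dist]) measurable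
    \<comment> \<open>The inner integral is 8 c m times \<open>q x\<close>, and \<open>q\<close> is
      at most \<epsilon> on the support of the indicator.\<close>
    also have "\<dots> \<le> (\<integral>\<^sup>+x. ennreal (c * (8 * m) * \<epsilon>) * indicator {-1/m..1/m} x \<partial>lborel)"
    proof (rule nn_integral_mono)
      fix x :: real
      show "(\<integral>\<^sup>+s\<in>{0<..T}. ennreal (?W x) * p s x \<partial>lborel)
          \<le> ennreal (c * (8 * m) * \<epsilon>) * indicator {-1/m..1/m} x"
      proof (cases "x \<in> {-1/m..1/m}")
        case True
        have [measurable]: "(\<lambda>s. p s x * indicator {0<..T} s) \<in> borel_measurable lborel"
          using measurable_compose[OF measurable_Pair2'[of x lborel lborel] pm] by simp
        have "(\<integral>\<^sup>+s\<in>{0<..T}. ennreal (?W x) * p s x \<partial>lborel)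
            = (\<integral>\<^sup>+s. ennreal (c * (8 * m)) * (ennreal (\<bar>x\<bar> powr a) * (p s x * indicator {0<..T} s)) \<partial>lborel)"
          using True c m(1) by (simp add: ennreal_mult mult_ac)
        also have "\<dots> = ennreal (c * (8 * m)) * q x"
          by (subst nn_integral_cmult) (auto simp: q_def mult.assoc)
        also have "\<dots> \<le> ennreal (c * (8 * m)) * ennreal \<epsilon>"
          using True by (intro mult_left_mono q_le) auto
        also have "\<dots> = ennreal (c * (8 * m) * \<epsilon>)"
          using c m(1) \<open>0 < \<epsilon>\<close> by (simp add: ennreal_mult)
        finally show ?thesis using True by simp
      qed simp
    qed
    also have "\<dots> = ennreal (c * (8 * m) * \<epsilon>) * ennreal (2 / m)"
      using m(1) by (subst nn_integral_cmult_indicator) auto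
    \<comment> \<open>The interval length 2/m cancels the slope m of the spike, leaving 8 *
      2.\<close>
    also have "\<dots> = ennreal (16 * c * \<epsilon>)"
      using c m(1) \<open>0 < \<epsilon>\<close> by (simp flip: ennreal_mult)
    finally show "(\<integral>\<^sup>+\<omega>. (\<integral>\<^sup>+s\<in>{0..T}. ennreal (?W (X s \<omega>)) \<partial>lborel) \<partial>M) \<le> ennreal (16 * c * \<epsilon>)" .
  qed
qed

text \<open>The order of choices is \<epsilon>, then m, then the spike of width 2/m. For each such
  spike the corrected process satisfies the martingale identity exactly; only the comparison with
  the given process costs a multiple of \<epsilon>.\<close>

lemma bounded_L_triple_martingale:
  fixes p :: "real \<Rightarrow> real \<Rightarrow> ennreal"
  assumes \<delta>: "0 \<le> \<delta>" "\<delta> < 1"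
    and mp: "\<And>h. h \<in> dom_L \<delta> \<Longrightarrow> local_martingale_upto (completion M) F T (compensated h (L_op \<delta> h))"
    and p: "case_prod p \<in> borel_measurable (restrict_space borel {0<..T} \<Otimes>\<^sub>M borel)"
    and dist: "AE t in lborel. t \<in> {0<..T} \<longrightarrow> distributed M lborel (X t) (p t)"
    and lim: "((\<lambda>x. \<integral>\<^sup>+t\<in>{0<..T}. ennreal (\<bar>x\<bar> powr (1 - \<delta>)) * p t x \<partial>lborel) \<longlongrightarrow> 0) (at 0)"
    and tr: "L_triple \<delta> f g G" and bd: "\<And>x. \<bar>f x\<bar> \<le> C" "\<And>x. \<bar>G x\<bar> \<le> C"
  shows "martingale_upto (completion M) F T (compensated f (\<lambda>x. G x / 2))"
proof (rule N.martingale_upto_boundedI[OF subalgebra_F])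
  note tr' = L_tripleD[OF tr]
  have cG: "continuous_on UNIV (\<lambda>x. G x / 2)" by (intro continuous_intros tr') simp
  have C: "0 \<le> C" using bd(1)[of 0] by linarith
  have bG: "\<bar>G x / 2\<bar> \<le> C" for x using bd(2)[of x] by linarith
  show "compensated f (\<lambda>x. G x / 2) t \<in> borel_measurable (F t)" if "t \<in> {0..T}" for t
    by (rule compensated_adapted[OF tr'(1) cG that])
  show "\<bar>compensated f (\<lambda>x. G x / 2) t \<omega>\<bar> \<le> 2 * C + C * T"
    if "t \<in> {0..T}" "\<omega> \<in> space (completion M)" for t \<omega>
    using that by (intro compensated_bound bd bG cG) auto
  fix s t A assume st: "0 \<le> s" "s \<le> t" "t \<le> T" and A: "A \<in> sets (F s)"
  have AM: "A \<in> sets (completion M)" using A subalgebra_F[of s] by (auto simp: subalgebra_def)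
  let ?I = "\<lambda>t. LINT \<omega>:A|completion M. compensated f (\<lambda>x. G x / 2) t \<omega>"
  define \<gamma> where "\<gamma> = \<bar>g 0\<bar>"
  \<comment> \<open>The 20 is 2 * (2 + 8): at each of the two times the functions contribute twice
    \<gamma> \<epsilon>, and the operators contribute 16 * (\<gamma> / 2) * \<epsilon> in
    mean.\<close>
  have est: "\<bar>?I t - ?I s\<bar> \<le> 20 * \<gamma> * \<epsilon>" if \<epsilon>: "\<epsilon> > 0" for \<epsilon>
  proof -
    obtain m where m: "1 \<le> m" "1 / m \<le> \<epsilon>" and occ:
      "\<And>c. 0 \<le> c \<Longrightarrow> (\<integral>\<^sup>+\<omega>. (\<integral>\<^sup>+s\<in>{0..T}.
        ennreal (c * (8 * m * \<bar>X s \<omega>\<bar> powr (1 - \<delta>) * indicator {-1/m..1/m} (X s \<omega>))) \<partial>lborel) \<partial>M)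
        \<le> ennreal (16 * c * \<epsilon>)"
      by (rule small_occupation_near_zero[OF p dist lim \<epsilon>]) blast
    obtain k \<zeta> K where k: "L_triple \<delta> k \<zeta> K" "\<zeta> 0 = 1" "\<And>x. \<bar>k x\<bar> \<le> 1 / m"
      "\<And>x. \<bar>K x\<bar> \<le> 8 * m * \<bar>x\<bar> powr (1 - \<delta>) * indicator {-1/m..1/m} x"
      by (rule L_triple_spike[OF \<delta> m(1)]) blast
    \<comment> \<open>The operators differ by half of \<open>g 0 * K\<close>, which is where
      \<gamma> / 2 comes from.\<close>
    define W where "W x = \<gamma> / 2 * (8 * m * \<bar>x\<bar> powr (1 - \<delta>) * indicator {-1/m..1/m} x)" for x :: real
    have [measurable]: "W \<in> borel_measurable borel" unfolding W_def[abs_def] by measurable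
    define h H where "h x = f x - g 0 * k x" and "H x = (G x - g 0 * K x) / 2" for x
    have trh: "L_triple \<delta> h (\<lambda>x. g x - g 0 * \<zeta> x) (\<lambda>x. G x - g 0 * K x)"
      unfolding h_def[abs_def] by (rule L_triple_diff[OF tr k(1)])
    have hD: "h \<in> dom_L \<delta>" and "L_op \<delta> h = H"
      using L_triple_dom_L[OF trh _ \<delta>] by (auto simp: k(2) H_def fun_eq_iff)
    then have loc: "local_martingale_upto (completion M) F T (compensated h H)"
      using mp[OF hD] by simp
    have ch: "continuous_on UNIV h" by (rule L_tripleD(1)[OF trh])
    have cH: "continuous_on UNIV H"
      unfolding H_def by (intro continuous_intros L_tripleD(3)[OF trh]) simp
    have kb: "\<bar>k x\<bar> \<le> 1" for x using k(3)[of x] m(1) by (smt (verit) divide_le_eq_1)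
    have Kb: "\<bar>K x\<bar> \<le> 8 * m" for x
    proof (cases "x \<in> {-1/m..1/m}")
      case True
      then have "\<bar>x\<bar> \<le> 1 / m" by auto
      also have "\<dots> \<le> 1" using m(1) by simp
      finally have "\<bar>x\<bar> powr (1 - \<delta>) \<le> 1" using \<delta> by (intro powr_le1) auto
      then have "8 * m * \<bar>x\<bar> powr (1 - \<delta>) \<le> 8 * m * 1" using m(1) by (intro mult_left_mono) auto
      then show ?thesis using k(4)[of x] True by simp
    next
      case False
      then show ?thesis using k(4)[of x] m(1) by simp
    qed
    \<comment> \<open>This bound grows with m, which is harmless: it turns a local martingale into a
      martingale and gives integrability, but does not enter the estimate. As 8 m >= 1, it covers
      both k and K.\<close>
    define C' where "C' = C + \<gamma> * (8 * m)"
    have C': "C \<le> C'" using m(1) by (simp add: C'_def \<gamma>_def)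
    have hb: "\<bar>h x\<bar> \<le> C'" for x
    proof -
      have "\<bar>h x\<bar> \<le> \<bar>f x\<bar> + \<gamma> * \<bar>k x\<bar>"
        unfolding h_def \<gamma>_def by (metis abs_mult abs_triangle_ineq4)
      also have "\<dots> \<le> C + \<gamma> * (8 * m)"
        using kb[of x] m(1) by (intro add_mono bd mult_left_mono) (auto simp: \<gamma>_def)
      finally show ?thesis by (simp add: C'_def)
    qed
    have Hb: "\<bar>H x\<bar> \<le> C'" for x
    proof -
      have "\<bar>G x - g 0 * K x\<bar> \<le> \<bar>G x\<bar> + \<gamma> * \<bar>K x\<bar>"
        unfolding \<gamma>_def by (metis abs_mult abs_triangle_ineq4)
      also have "\<dots> \<le> C + \<gamma> * (8 * m)"
        using Kb[of x] by (intro add_mono bd mult_left_mono) (auto simp: \<gamma>_def)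
      finally show ?thesis using C C' by (simp add: C'_def H_def)
    qed
    have mart: "martingale_upto (completion M) F T (compensated h H)"
      by (rule N.bounded_local_martingale_upto[OF subalgebra_F loc compensated_bound[OF hb Hb cH]]) auto
    have "(LINT \<omega>:A|completion M. compensated h H t \<omega>) = (LINT \<omega>:A|completion M. compensated h H s \<omega>)"
      by (rule N.martingale_upto_set_integral[OF mart subalgebra_F st A])
    moreover have "\<bar>?I r - (LINT \<omega>:A|completion M. compensated h H r \<omega>)\<bar> \<le> 2 * (\<gamma> * \<epsilon>) + 8 * \<gamma> * \<epsilon>"
      if r: "r \<in> {0..T}" for r
    proof (rule compensated_set_integral_diff[where C=C' and W=W, OF tr'(1) ch cG cH])
      show "\<bar>f x\<bar> \<le> C'" "\<bar>G x / 2\<bar> \<le> C'" for x using bd(1)[of x] bG[of x] C' by auto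
      show "\<bar>f x - h x\<bar> \<le> \<gamma> * \<epsilon>" for x
        using k(3)[of x] m(2) by (auto simp: h_def \<gamma>_def abs_mult intro!: mult_left_mono)
      show "\<bar>G x / 2 - H x\<bar> \<le> W x" for x
      proof -
        have diff: "G x / 2 - H x = g 0 / 2 * K x" by (simp add: H_def field_simps)
        have "\<bar>G x / 2 - H x\<bar> = \<gamma> / 2 * \<bar>K x\<bar>" unfolding diff by (simp add: \<gamma>_def abs_mult)
        also have "\<dots> \<le> W x"
          unfolding W_def using k(4)[of x] by (intro mult_left_mono) (auto simp: \<gamma>_def)
        finally show ?thesis .
      qed
      show "(\<integral>\<^sup>+\<omega>. (\<integral>\<^sup>+s\<in>{0..T}. ennreal (W (X s \<omega>)) \<partial>lborel) \<partial>M) \<le> ennreal (8 * \<gamma> * \<epsilon>)"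
        using occ[of "\<gamma> / 2"] by (simp add: W_def \<gamma>_def)
      show "0 \<le> 8 * \<gamma> * \<epsilon>" using \<epsilon> by (simp add: \<gamma>_def)
      show "(\<lambda>\<omega>. \<integral>\<^sup>+s\<in>{0..T}. ennreal (W (X s \<omega>)) \<partial>lborel) \<in> borel_measurable M"
        by (rule nn_integral_comp_X_measurable) measurable
    qed (use hb Hb r AM in auto)
    from this[of t] this[of s] have
      "\<bar>?I t - (LINT \<omega>:A|completion M. compensated h H t \<omega>)\<bar> \<le> 2 * (\<gamma> * \<epsilon>) + 8 * \<gamma> * \<epsilon>"
      "\<bar>?I s - (LINT \<omega>:A|completion M. compensated h H s \<omega>)\<bar> \<le> 2 * (\<gamma> * \<epsilon>) + 8 * \<gamma> * \<epsilon>"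
      using st by auto
    moreover have "\<bar>a - b\<bar> \<le> 2 * B" if "c = d" "\<bar>a - c\<bar> \<le> B" "\<bar>b - d\<bar> \<le> B" for a b c d B :: real
      using that by linarith
    ultimately have "\<bar>?I t - ?I s\<bar> \<le> 2 * (2 * (\<gamma> * \<epsilon>) + 8 * \<gamma> * \<epsilon>)"
      by blast
    then show ?thesis by (simp add: mult_ac)
  qed
  have "\<bar>?I t - ?I s\<bar> \<le> 0"
  proof (rule field_le_epsilon)
    fix e :: real assume "0 < e"
    \<comment> \<open>The added 1 keeps the divisor positive when g(0) = 0.\<close>
    have "\<bar>?I t - ?I s\<bar> \<le> 20 * \<gamma> * (e / (20 * \<gamma> + 1))"
      using \<open>0 < e\<close> by (intro est) (simp add: \<gamma>_def add_nonneg_pos)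
    also have "\<dots> \<le> e"
    proof -
      have "0 \<le> \<gamma>" by (simp add: \<gamma>_def)
      then show ?thesis using \<open>0 < e\<close> by (simp add: field_simps)
    qed
    finally show "\<bar>?I t - ?I s\<bar> \<le> 0 + e" by simp
  qed
  then show "?I t = ?I s" by simp
qed

text \<open>Up to and including the exit time the path stays in [-R, R], so neither term sees the
  functions outside. The initial value must lie there too, because \<open>f x0\<close> is part of
  the process.\<close>

lemma compensated_eq_before_exit:
  assumes eq: "\<And>x. \<bar>x\<bar> \<le> R \<Longrightarrow> f1 x = f2 x" "\<And>x. \<bar>x\<bar> \<le> R \<Longrightarrow> H1 x = H2 x"
    and R: "\<bar>x0\<bar> \<le> R" and w: "\<omega> \<in> space M" and r: "0 \<le> r" "r \<le> exit_time R \<omega>"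
  shows "compensated f1 H1 r \<omega> = compensated f2 H2 r \<omega>"
proof -
  have "\<bar>X s \<omega>\<bar> \<le> R" if "s \<in> {0..r}" for s
    using that r by (intro bounded_before_exit[OF w R]) auto
  then have "(LINT s:{0..r}|lborel. H1 (X s \<omega>)) = (LINT s:{0..r}|lborel. H2 (X s \<omega>))"
    by (intro set_lebesgue_integral_cong) (auto simp: eq)
  moreover have "\<bar>X r \<omega>\<bar> \<le> R" by (rule bounded_before_exit[OF w R r])
  ultimately show ?thesis by (simp add: compensated_def eq R)
qed

lemma local_martingale_compensated_dom_L_hat:
  fixes p :: "real \<Rightarrow> real \<Rightarrow> ennreal"
  assumes \<delta>: "0 \<le> \<delta>" "\<delta> < 1"
    and mp: "\<And>h. h \<in> dom_L \<delta> \<Longrightarrow> local_martingale_upto (completion M) F T (compensated h (L_op \<delta> h))"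
    and p: "case_prod p \<in> borel_measurable (restrict_space borel {0<..T} \<Otimes>\<^sub>M borel)"
    and dist: "AE t in lborel. t \<in> {0<..T} \<longrightarrow> distributed M lborel (X t) (p t)"
    and lim: "((\<lambda>x. \<integral>\<^sup>+t\<in>{0<..T}. ennreal (\<bar>x\<bar> powr (1 - \<delta>)) * p t x \<partial>lborel) \<longlongrightarrow> 0) (at 0)"
    and f: "f \<in> dom_L_hat \<delta>"
  shows "local_martingale_upto (completion M) F T (compensated f (L_op \<delta> f))"
proof -
  obtain g G where tr: "L_triple \<delta> f g G" and "\<And>x. L_op \<delta> f x = G x / 2"
    by (rule dom_L_hat_imp_L_triple[OF f \<delta>(2)]) blast
  then have L: "L_op \<delta> f = (\<lambda>x. G x / 2)" by auto
  have cG: "continuous_on UNIV (\<lambda>x. G x / 2)" by (intro continuous_intros L_tripleD(3)[OF tr]) simp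
  \<comment> \<open>The levels start at |x0|, so the initial point lies in every interval. For n = 0
    the exit time is 0, which a localizing sequence permits.\<close>
  define \<tau> where "\<tau> n = exit_time (\<bar>x0\<bar> + real n)" for n :: nat
  have mart: "martingale_upto (completion M) F T (\<lambda>t \<omega>. compensated f (\<lambda>x. G x / 2) (min t (\<tau> n \<omega>)) \<omega>)" for n
  proof -
    define R where "R = \<bar>x0\<bar> + real n"
    have "0 \<le> R" and R: "\<bar>x0\<bar> \<le> R" by (simp_all add: R_def)
    obtain fR gR GR C where fR: "L_triple \<delta> fR gR GR"
      "\<And>x. \<bar>x\<bar> \<le> R \<Longrightarrow> fR x = f x" "\<And>x. \<bar>x\<bar> \<le> R \<Longrightarrow> GR x = G x"
      "\<And>x. \<bar>fR x\<bar> \<le> C" "\<And>x. \<bar>GR x\<bar> \<le> C"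
      by (rule L_triple_truncate[OF tr \<delta>(2) \<open>0 \<le> R\<close>]) blast
    let ?Y = "compensated fR (\<lambda>x. GR x / 2)"
    have cGR: "continuous_on UNIV (\<lambda>x. GR x / 2)"
      by (intro continuous_intros L_tripleD(3)[OF fR(1)]) simp
    have bGR: "\<bar>GR x / 2\<bar> \<le> C" for x using fR(5)[of x] by linarith
    have Y: "martingale_upto (completion M) F T ?Y"
      by (rule bounded_L_triple_martingale[OF \<delta> mp p dist lim fR(1,4,5)])
    have "martingale_upto (completion M) F T (\<lambda>t \<omega>. ?Y (min t (\<tau> n \<omega>)) \<omega>)"
    proof (rule N.martingale_upto_stopped[OF subalgebra_F sets_F_mono Y])
      show "\<bar>?Y t \<omega>\<bar> \<le> 2 * C + C * T" if "t \<in> {0..T}" "\<omega> \<in> space (completion M)" for t \<omega>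
        using that by (intro compensated_bound fR bGR cGR) auto
      show "continuous_on {0..T} (\<lambda>t. ?Y t \<omega>)" if "\<omega> \<in> space (completion M)" for \<omega>
        using that by (intro compensated_continuous L_tripleD(1)[OF fR(1)] cGR) auto
      show "stopping_time F (\<tau> n)" unfolding \<tau>_def by (rule stopping_time_exit)
      show "\<tau> n \<omega> \<in> {0..T}" if "\<omega> \<in> space (completion M)" for \<omega>
        unfolding \<tau>_def using that by (intro exit_time_range) simp
    qed
    then show ?thesis
    proof (rule N.martingale_upto_cong[OF _ subalgebra_F])
      fix t \<omega> assume t: "t \<in> {0..T}" and "\<omega> \<in> space (completion M)"
      then have w: "\<omega> \<in> space M" by simp
      show "?Y (min t (\<tau> n \<omega>)) \<omega> = compensated f (\<lambda>x. G x / 2) (min t (\<tau> n \<omega>)) \<omega>"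
      proof (rule compensated_eq_before_exit[OF _ _ R w])
        show "0 \<le> min t (\<tau> n \<omega>)" using t exit_time_range[OF w] by (simp add: \<tau>_def)
        show "min t (\<tau> n \<omega>) \<le> exit_time R \<omega>" by (simp add: \<tau>_def R_def)
      qed (simp_all add: fR)
    qed
  qed
  show ?thesis
    unfolding local_martingale_upto_def L
  proof (intro conjI ballI exI[of _ \<tau>] allI mart)
    show "compensated f (\<lambda>x. G x / 2) t \<in> borel_measurable (F t)" if "t \<in> {0..T}" for t
      by (rule compensated_adapted[OF L_tripleD(1)[OF tr] cG that])
    show "stopping_time F (\<tau> n)" for n unfolding \<tau>_def by (rule stopping_time_exit)
    show "\<tau> n \<omega> \<in> {0..T}" if "\<omega> \<in> space (completion M)" for n \<omega>
      unfolding \<tau>_def using that by (intro exit_time_range) simp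
    show "AE \<omega> in completion M. incseq (\<lambda>n. \<tau> n \<omega>) \<and> (\<exists>n. \<tau> n \<omega> = T)"
    proof (rule AE_I2, intro conjI)
      fix \<omega> assume "\<omega> \<in> space (completion M)"
      then show "\<exists>n. \<tau> n \<omega> = T" unfolding \<tau>_def by (intro exit_time_eventually_T) simp
      show "incseq (\<lambda>n. \<tau> n \<omega>)"
        unfolding \<tau>_def by (intro monoI exit_time_mono) simp
    qed
  qed
qed

end

theorem proposition3p16:
  fixes M :: "'a measure" and T \<delta> x0 :: real
    and X :: "real \<Rightarrow> 'a \<Rightarrow> real" and p :: "real \<Rightarrow> real \<Rightarrow> ennreal"
  assumes "prob_space M"
    and "0 < T" and "0 \<le> \<delta>" and "\<delta> < 1"
    and "solves_martingale_problem M T \<delta> (dom_L \<delta>) x0 X"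
    and "case_prod p \<in> borel_measurable (restrict_space borel {0<..T} \<Otimes>\<^sub>M borel)"
    and "AE t in lborel. t \<in> {0<..T} \<longrightarrow> distributed M lborel (X t) (p t)"
    and "((\<lambda>x. \<integral>\<^sup>+t\<in>{0<..T}. ennreal (\<bar>x\<bar> powr (1 - \<delta>)) * p t x \<partial>lborel) \<longlongrightarrow> 0) (at 0)"
  shows "solves_martingale_problem M T \<delta> (dom_L_hat \<delta>) x0 X"
proof -
  interpret prob_space M by fact
  interpret continuous_process M T x0 X
    by unfold_locales (use assms(2,5) in \<open>auto simp: solves_martingale_problem_def\<close>)
  have comp: "(\<lambda>t \<omega>. f (X t \<omega>) - f x0 - (LINT s:{0..t}|lborel. L_op \<delta> f (X s \<omega>)))
      = compensated f (L_op \<delta> f)" for f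
    by (simp add: compensated_def fun_eq_iff)
  have mp: "local_martingale_upto (completion M) F T (compensated h (L_op \<delta> h))" if "h \<in> dom_L \<delta>" for h
    using assms(5) that unfolding solves_martingale_problem_def comp by blast
  \<comment> \<open>Measurability, continuity and the initial value carry over unchanged; only the
    clause on test functions depends on the domain.\<close>
  show ?thesis
    using assms(5) local_martingale_compensated_dom_L_hat[OF assms(3,4) mp assms(6-8)]
    unfolding solves_martingale_problem_def comp by blast
qed

end
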